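(* Let $\bar x\in\operatorname{dom}F$ and let $W$ be a neighborhood of $R(\bar x)$ such that for every $i\in\{1,\dots,n\}$: if $r_i$ is not $\mathcal C^1$ on any neighborhood of $\bar x$, then $\nabla_i s(z)\ge 0$ for all $z\in W$. Define $$\mathcal I_{\bar x}:=\{\,i\in\{1,\dots,n\}:\ \nabla_i s(z)\ge 0\ \text{for all } z\in W\,\},$$ so that for every $i\notin\mathcal I_{\bar x}$ the function $r_i$ is $\mathcal C^1$ on a neighborhood of $\bar x$. Then $F$ is subdifferentially regular at $\bar x$; in particular its Fréchet and limiting subdifferentials coincide: $\widehat\partial F(\bar x)=\partial F(\bar x)$. Moreover, $$\partial F(\bar x)=\partial g(\bar x)+\nabla C(\bar x)^{\top}\,\partial h(C(\bar x))+\sum_{i\in\mathcal I_{\bar x}}\nabla_i s(R(\bar x))\,\partial r_i(\bar x)+\sum_{i\notin\mathcal I_{\bar x}}\nabla_i s(R(\bar x))\,\nabla r_i(\bar x),$$ where the sums are Minkowski sums.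
   Context: $F:\mathbb R^m\to\mathbb R\cup\{+\infty\}$ is given by $F(x)=g(x)+h(C(x))+s(R(x))$, where $g:\mathbb R^m\to\mathbb R\cup\{+\infty\}$ is proper, closed and convex; $h:\mathbb R^d\to\mathbb R$ is finite-valued, closed and convex; $C:\mathbb R^m\to\mathbb R^d$ and $s:\mathbb R^n\to\mathbb R$ are $\mathcal C^1$; and $R(x)=(r_1(x),\dots,r_n(x))$ with each $r_i:\mathbb R^m\to\mathbb R$ finite-valued, closed and convex (possibly nonsmooth). $\nabla C(\bar x)$ is the $d\times m$ Jacobian and $\nabla_i s$ is the $i$-th partial derivative of $s$. $\widehat\partial F$ denotes the Fréchet (regular) subdifferential and $\partial F$ the limiting (Mordukhovich) subdifferential; for convex functions $\partial$ is the usual convex subdifferential. Subdifferential regularity is in the sense of Rockafellar--Wets, Variational Analysis (the epigraph of $F$ is Clarke regular at $(\bar x,F(\bar x))$). *)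

theory Defs
  imports "HOL-Analysis.Analysis"
begin

text \<open>
  Functions into \<open>\<real> \<union> {+\<infinity>}\<close> are represented as functions into \<^typ>\<open>ereal\<close>; properness excludes
  the value \<open>-\<infinity>\<close>. The epigraph contains only points with a real second component, so it is a subset
  of the Euclidean space \<open>'a \<times> real\<close>.
\<close>

definition effective_domain :: "('a \<Rightarrow> ereal) \<Rightarrow> 'a set" where
  "effective_domain f = {x. f x < \<infinity>}"

definition ereal_epigraph :: "('a \<Rightarrow> ereal) \<Rightarrow> ('a \<times> real) set" where
  "ereal_epigraph f = {(x, a). f x \<le> ereal a}"

definition proper_fun :: "('a \<Rightarrow> ereal) \<Rightarrow> bool" where
  "proper_fun f \<longleftrightarrow> (\<forall>x. f x \<noteq> -\<infinity>) \<and> effective_domain f \<noteq> {}"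

definition closed_fun :: "('a::topological_space \<Rightarrow> ereal) \<Rightarrow> bool" where
  "closed_fun f \<longleftrightarrow> closed (ereal_epigraph f)"

definition convex_fun :: "('a::real_vector \<Rightarrow> ereal) \<Rightarrow> bool" where
  "convex_fun f \<longleftrightarrow> convex (ereal_epigraph f)"

definition convex_subdifferential :: "('a::real_inner \<Rightarrow> ereal) \<Rightarrow> 'a \<Rightarrow> 'a set" where
  "convex_subdifferential f x =
    {v. \<bar>f x\<bar> \<noteq> \<infinity> \<and> (\<forall>y. f x + ereal (v \<bullet> (y - x)) \<le> f y)}"

definition frechet_subdifferential :: "('a::real_inner \<Rightarrow> ereal) \<Rightarrow> 'a \<Rightarrow> 'a set" where
  "frechet_subdifferential f x =
    {v. \<bar>f x\<bar> \<noteq> \<infinity> \<and>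
        0 \<le> Liminf (at x) (\<lambda>y. (f y - f x - ereal (v \<bullet> (y - x))) / ereal (norm (y - x)))}"

definition limiting_subdifferential :: "('a::real_inner \<Rightarrow> ereal) \<Rightarrow> 'a \<Rightarrow> 'a set" where
  "limiting_subdifferential f x =
    {v. \<bar>f x\<bar> \<noteq> \<infinity> \<and>
        (\<exists>y w. y \<longlonglongrightarrow> x \<and> (\<lambda>k. f (y k)) \<longlonglongrightarrow> f x \<and>
               (\<forall>k. w k \<in> frechet_subdifferential f (y k)) \<and> w \<longlonglongrightarrow> v)}"

text \<open>
  Clarke regularity of sets and subdifferential regularity of functions follow Rockafellar and Wets,
  Variational Analysis, Definitions 6.3, 6.4 and 7.25.
\<close>

definition regular_normal_cone :: "'a::real_inner set \<Rightarrow> 'a \<Rightarrow> 'a set" where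
  "regular_normal_cone S x =
    {v. x \<in> S \<and> Limsup (at x within S) (\<lambda>y. ereal (v \<bullet> (y - x) / norm (y - x))) \<le> 0}"

definition limiting_normal_cone :: "'a::real_inner set \<Rightarrow> 'a \<Rightarrow> 'a set" where
  "limiting_normal_cone S x =
    {v. x \<in> S \<and>
        (\<exists>y w. (\<forall>k. y k \<in> S) \<and> y \<longlonglongrightarrow> x \<and>
               (\<forall>k. w k \<in> regular_normal_cone S (y k)) \<and> w \<longlonglongrightarrow> v)}"

definition locally_closed_at :: "'a::topological_space set \<Rightarrow> 'a \<Rightarrow> bool" where
  "locally_closed_at S x \<longleftrightarrow> (\<exists>V. closed V \<and> x \<in> interior V \<and> closed (S \<inter> V))"

definition clarke_regular_at :: "'a::real_inner set \<Rightarrow> 'a \<Rightarrow> bool" where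
  "clarke_regular_at S x \<longleftrightarrow>
    x \<in> S \<and> locally_closed_at S x \<and> limiting_normal_cone S x = regular_normal_cone S x"

definition subdifferentially_regular_at :: "('a::real_inner \<Rightarrow> ereal) \<Rightarrow> 'a \<Rightarrow> bool" where
  "subdifferentially_regular_at f x \<longleftrightarrow>
    \<bar>f x\<bar> \<noteq> \<infinity> \<and> clarke_regular_at (ereal_epigraph f) (x, real_of_ereal (f x))"

text \<open>Meant for open \<open>U\<close>, since the derivative is taken with respect to the whole space.\<close>

definition continuously_differentiable_on ::
    "('a::real_normed_vector \<Rightarrow> 'b::real_normed_vector) \<Rightarrow> 'a set \<Rightarrow> bool" where
  "continuously_differentiable_on f U \<longleftrightarrow>
    (\<exists>f' :: 'a \<Rightarrow> 'a \<Rightarrow>\<^sub>L 'b.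
        (\<forall>x\<in>U. (f has_derivative blinfun_apply (f' x)) (at x)) \<and> continuous_on U f')"

definition continuously_differentiable_near ::
    "('a::real_normed_vector \<Rightarrow> 'b::real_normed_vector) \<Rightarrow> 'a \<Rightarrow> bool" where
  "continuously_differentiable_near f x \<longleftrightarrow>
    (\<exists>U. open U \<and> x \<in> U \<and> continuously_differentiable_on f U)"

definition partial_deriv :: "'n \<Rightarrow> (real ^ 'n::finite \<Rightarrow> real) \<Rightarrow> real ^ 'n \<Rightarrow> real" where
  "partial_deriv i f x = deriv (\<lambda>t. f (x + t *\<^sub>R axis i 1)) 0"

definition gradient :: "(real ^ 'n::finite \<Rightarrow> real) \<Rightarrow> real ^ 'n \<Rightarrow> real ^ 'n" where
  "gradient f x = (\<chi> i. partial_deriv i f x)"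

end

theory Submission
  imports Defs
begin

text \<open>
  Both assertions rest on a splitting of \<open>F\<close> near \<open>xbar\<close>. Let \<open>c i\<close> be the partial derivatives of
  \<open>s\<close> at \<open>R xbar\<close> and \<open>A\<close> its derivative there. Then \<open>F\<close> is the sum of
  \<^item> \<open>g\<close> and \<open>\<Sum>i\<in>I. c i * r i\<close>, which are convex because \<open>c i \<ge> 0\<close> for \<open>i \<in> I\<close>;
  \<^item> \<open>h \<circ> C\<close>;
  \<^item> \<open>\<Sum>i\<in>-I. c i * r i\<close>, which is strictly differentiable at \<open>xbar\<close>;
  \<^item> \<open>s \<circ> R - A \<circ> R\<close>, which is strictly differentiable at \<open>xbar\<close> with derivative zero, because
    finite convex functions are locally Lipschitz and hence \<open>R\<close> is.

  Regularity. Each summand is approximately convex at \<open>xbar\<close>: it satisfies the convexity inequality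
  for \<open>y, z\<close> near \<open>xbar\<close> up to an error \<open>\<epsilon> * t * norm (y - z)\<close> with \<open>\<epsilon>\<close> as small as desired.
  This property is stable under sums. A regular normal to the epigraph of such a function at any point
  near \<open>xbar\<close> satisfies the normal inequality of a convex set on a whole neighbourhood of
  \<open>xbar\<close>, up to the error \<open>\<epsilon>\<close>, and the neighbourhood does not depend on the base point
  (\<open>limiting_normal_inequality\<close>). The inequality therefore passes to limits of normals, and every
  limiting normal is regular. Horizontal normals are included, which gives Clarke regularity of the
  epigraph and not only equality of the two subdifferentials.

  The formula. Frechet subgradients at \<open>xbar\<close> depend only on the first-order behaviour of the finite
  summands (\<open>frechet_subdifferential_add_cong\<close>). Replacing \<open>C\<close> by its linearization, dropping
  \<open>s \<circ> R - A \<circ> R\<close>, and replacing \<open>r i\<close> for \<open>i \<notin> I\<close> by a linear function turns \<open>F\<close> into a convex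
  function, whose Frechet subdifferential is the convex one. The exact sum and chain rules for convex
  functions then give the formula; they both follow from one separation argument
  (\<open>convex_subgradient_split\<close>).
\<close>

section \<open>Local behaviour of finite convex functions and strict derivatives\<close>

text \<open>The slopes of a convex function increase along a line. So the slope from \<open>y\<close> to \<open>z\<close> is at most the
  slope over a further segment of unit length, which a bound \<open>M\<close> for \<open>\<bar>f\<bar>\<close> on a larger ball limits
  to \<open>2 * M\<close>.\<close>

lemma convex_on_UNIV_locally_lipschitz:
  fixes f :: "'a::euclidean_space \<Rightarrow> real"
  assumes f: "convex_on UNIV f"
  obtains \<delta> L where "0 < \<delta>" "L-lipschitz_on (ball x \<delta>) f"
proof -
  have "compact (f ` cball x 2)"
    by (intro compact_continuous_image compact_cball continuous_on_subset[OF convex_on_continuous[OF _ f]]) auto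
  then obtain M where M: "\<And>y. y \<in> cball x 2 \<Longrightarrow> \<bar>f y\<bar> \<le> M"
    by (force dest!: compact_imp_bounded simp: bounded_iff)
  have M0: "0 \<le> M" using M[of x] by simp
  have one_sided: "f z - f y \<le> 2 * M * norm (z - y)" if yz: "y \<in> ball x 1" "z \<in> ball x 1" for y z
  proof (cases "y = z")
    case False
    define e where "e = norm (z - y)"
    have e: "0 < e" using False by (simp add: e_def)
    \<comment> \<open>Prolonging the segment beyond \<open>z\<close> by unit length stays in the ball of radius 2.\<close>
    define u where "u = z + (1 / e) *\<^sub>R (z - y)"
    define l where "l = e / (1 + e)"
    have "norm (u - z) = 1" using e by (simp add: u_def e_def)
    then have u: "u \<in> cball x 2"
      using yz norm_triangle_ineq[of "u - z" "z - x"] by (simp add: dist_norm norm_minus_commute)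
    have l: "0 \<le> l" "l \<le> 1" "l \<le> e" using e by (auto simp: l_def field_simps)
    have "(1 - l) *\<^sub>R y + l *\<^sub>R u = y + (l * (1 + 1 / e)) *\<^sub>R (z - y)"
      by (simp add: u_def algebra_simps)
    also have "l * (1 + 1 / e) = 1"
      using e add_pos_pos[of e "e * e"] by (simp add: l_def field_simps)
    finally have z: "z = (1 - l) *\<^sub>R y + l *\<^sub>R u" by simp
    have "f z \<le> (1 - l) * f y + l * f u"
      unfolding z by (rule convex_onD[OF f]) (use l in auto)
    then have "f z - f y \<le> l * (f u - f y)" by (simp add: algebra_simps)
    also have "\<dots> \<le> l * (2 * M)"
      using M[OF u] M[of y] yz l by (intro mult_left_mono) (auto simp: abs_le_iff)
    also have "\<dots> \<le> e * (2 * M)" using l M0 by (intro mult_right_mono) auto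
    finally show ?thesis by (simp add: e_def mult.commute)
  qed simp
  have "(2 * M)-lipschitz_on (ball x 1) f"
  proof (rule lipschitz_onI)
    fix y z assume "y \<in> ball x 1" "z \<in> ball x 1"
    then show "dist (f y) (f z) \<le> 2 * M * dist y z"
      using one_sided[of y z] one_sided[of z y] by (auto simp: dist_norm norm_minus_commute abs_le_iff)
  qed (use M0 in simp)
  then show thesis by (rule that[rotated]) simp
qed

text \<open>Strict differentiability, whose usual form bounds the two-point quotient
  \<open>(f y - f z - A (y - z)) / norm (y - z)\<close> as \<open>y\<close> and \<open>z\<close> tend to \<open>x\<close>. The Lipschitz form
  makes compositions with Lipschitz maps immediate.\<close>

definition has_strict_derivative ::
    "('a::real_normed_vector \<Rightarrow> 'b::real_normed_vector) \<Rightarrow> ('a \<Rightarrow> 'b) \<Rightarrow> 'a \<Rightarrow> bool" where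
  "has_strict_derivative f A x \<longleftrightarrow>
    bounded_linear A \<and> (\<forall>\<epsilon>>0. \<exists>\<delta>>0. \<epsilon>-lipschitz_on (ball x \<delta>) (\<lambda>y. f y - A y))"

lemma has_strict_derivativeD:
  assumes "has_strict_derivative f A x" "0 < \<epsilon>"
  obtains \<delta> where "0 < \<delta>" "\<epsilon>-lipschitz_on (ball x \<delta>) (\<lambda>y. f y - A y)"
  using assms unfolding has_strict_derivative_def by blast

text \<open>The mean value inequality for \<open>f - f' x\<close>, whose derivative is small near \<open>x\<close> by continuity.\<close>

lemma continuously_differentiable_near_imp_has_strict_derivative:
  assumes "continuously_differentiable_near f x"
  obtains A where "has_strict_derivative f A x"
proof -
  obtain U f' where U: "open U" "x \<in> U"
    and d: "\<And>y. y \<in> U \<Longrightarrow> (f has_derivative blinfun_apply (f' y)) (at y)"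
    and c: "continuous_on U f'"
    using assms unfolding continuously_differentiable_near_def continuously_differentiable_on_def by blast
  have "has_strict_derivative f (blinfun_apply (f' x)) x"
    unfolding has_strict_derivative_def
  proof (intro conjI allI impI)
    fix \<epsilon> :: real assume e: "0 < \<epsilon>"
    obtain d1 where d1: "0 < d1" "\<And>y. y \<in> U \<Longrightarrow> dist y x < d1 \<Longrightarrow> dist (f' y) (f' x) < \<epsilon>"
      using c U(2) e unfolding continuous_on_iff by meson
    obtain d2 where d2: "0 < d2" "ball x d2 \<subseteq> U"
      using U openE by blast
    define \<delta> where "\<delta> = min d1 d2"
    have "\<epsilon>-lipschitz_on (ball x \<delta>) (\<lambda>y. f y - f' x y)"
    proof (rule lipschitz_onI)
      fix y z assume yz: "y \<in> ball x \<delta>" "z \<in> ball x \<delta>"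
      have "norm ((f y - f' x y) - (f z - f' x z)) \<le> \<epsilon> * norm (y - z)"
      proof (rule differentiable_bound[OF convex_ball _ _ yz])
        fix w assume w: "w \<in> ball x \<delta>"
        then have wU: "w \<in> U" using d2 by (auto simp: \<delta>_def)
        show "((\<lambda>y. f y - f' x y) has_derivative (blinfun_apply (f' w - f' x))) (at w within ball x \<delta>)"
          unfolding minus_blinfun.rep_eq
          by (intro has_derivative_diff has_derivative_at_withinI[OF d[OF wU]]
              bounded_linear_imp_has_derivative blinfun.bounded_linear_right)
        have "norm (f' w - f' x) < \<epsilon>"
          using d1(2)[OF wU] w by (simp add: \<delta>_def dist_norm norm_minus_commute)
        then show "onorm (blinfun_apply (f' w - f' x)) \<le> \<epsilon>"
          by (simp add: norm_blinfun.rep_eq)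
      qed
      then show "dist (f y - f' x y) (f z - f' x z) \<le> \<epsilon> * dist y z"
        by (simp add: dist_norm)
    qed (use e in simp)
    moreover have "0 < \<delta>" using d1 d2 by (simp add: \<delta>_def)
    ultimately show "\<exists>\<delta>>0. \<epsilon>-lipschitz_on (ball x \<delta>) (\<lambda>y. f y - f' x y)" by blast
  qed (rule blinfun.bounded_linear_right)
  then show thesis by (rule that)
qed

lemma has_strict_derivative_imp_has_derivative:
  assumes "has_strict_derivative f A x"
  shows "(f has_derivative A) (at x)"
  unfolding has_derivative_at_alt
proof (intro conjI allI impI)
  show A: "bounded_linear A" using assms by (simp add: has_strict_derivative_def)
  fix e :: real assume "0 < e"
  then obtain \<delta> where d: "0 < \<delta>" "e-lipschitz_on (ball x \<delta>) (\<lambda>y. f y - A y)"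
    using has_strict_derivativeD[OF assms] by blast
  show "\<exists>d>0. \<forall>y. norm (y - x) < d \<longrightarrow> norm (f y - f x - A (y - x)) \<le> e * norm (y - x)"
  proof (intro exI[of _ \<delta>] conjI allI impI d(1))
    fix y assume "norm (y - x) < \<delta>"
    then have "dist (f y - A y) (f x - A x) \<le> e * dist y x"
      using d by (intro lipschitz_onD[OF d(2)]) (auto simp: dist_norm norm_minus_commute)
    then show "norm (f y - f x - A (y - x)) \<le> e * norm (y - x)"
      by (simp add: dist_norm linear_diff[OF bounded_linear.linear[OF A]] algebra_simps)
  qed
qed

lemma has_strict_derivative_scaleR:
  assumes "has_strict_derivative f A x"
  shows "has_strict_derivative (\<lambda>y. c *\<^sub>R f y) (\<lambda>y. c *\<^sub>R A y) x"
  unfolding has_strict_derivative_def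
proof (intro conjI allI impI)
  show "bounded_linear (\<lambda>y. c *\<^sub>R A y)"
    using assms by (auto simp: has_strict_derivative_def intro: bounded_linear_const_scaleR)
  fix \<epsilon> :: real assume e: "0 < \<epsilon>"
  define \<eta> where "\<eta> = \<epsilon> / (1 + \<bar>c\<bar>)"
  have eta: "0 < \<eta>" "\<bar>c\<bar> * \<eta> \<le> \<epsilon>" using e by (auto simp: \<eta>_def field_simps)
  obtain \<delta> where d: "0 < \<delta>" "\<eta>-lipschitz_on (ball x \<delta>) (\<lambda>y. f y - A y)"
    using has_strict_derivativeD[OF assms eta(1)] .
  have "\<epsilon>-lipschitz_on (ball x \<delta>) (\<lambda>y. c *\<^sub>R (f y - A y))"
    by (rule lipschitz_on_mono[OF lipschitz_on_cmult[OF d(2)]]) (use eta in auto)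
  then show "\<exists>\<delta>>0. \<epsilon>-lipschitz_on (ball x \<delta>) (\<lambda>y. c *\<^sub>R f y - c *\<^sub>R A y)"
    using d(1) by (auto simp: scaleR_diff_right)
qed

text \<open>The nonlinear part of \<open>s\<close> has arbitrarily small Lipschitz constants near \<open>R x\<close>, and composing
  with a map that is merely Lipschitz preserves this. So all nonsmoothness of \<open>s \<circ> R\<close> to first order
  sits in the linear combination \<open>A \<circ> R\<close>.\<close>

lemma has_strict_derivative_compose_minus_linear:
  assumes s: "has_strict_derivative s A (R x)"
    and R: "L-lipschitz_on (ball x \<rho>) R" "0 < \<rho>"
  shows "has_strict_derivative (\<lambda>y. s (R y) - A (R y)) (\<lambda>_. 0) x"
  unfolding has_strict_derivative_def
proof (intro conjI allI impI)
  fix \<epsilon> :: real assume e: "0 < \<epsilon>"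
  have L: "0 \<le> L" using R(1) by (rule lipschitz_on_nonneg)
  define \<eta> where "\<eta> = \<epsilon> / (1 + L)"
  have eta: "0 < \<eta>" "\<eta> * L \<le> \<epsilon>" using e L by (auto simp: \<eta>_def field_simps)
  obtain d where d: "0 < d" "\<eta>-lipschitz_on (ball (R x) d) (\<lambda>y. s y - A y)"
    using has_strict_derivativeD[OF s eta(1)] .
  define \<delta> where "\<delta> = min \<rho> (d / (1 + L))"
  have sub: "R ` ball x \<delta> \<subseteq> ball (R x) d"
  proof (rule image_subsetI)
    fix y assume y: "y \<in> ball x \<delta>"
    have "dist (R x) (R y) \<le> L * dist x y"
      using y R(2) by (intro lipschitz_onD[OF R(1)]) (auto simp: \<delta>_def)
    also have "\<dots> \<le> L * (d / (1 + L))" using y L by (intro mult_left_mono) (auto simp: \<delta>_def)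
    also have "\<dots> < d" using d L by (simp add: field_simps)
    finally show "R y \<in> ball (R x) d" by simp
  qed
  have "\<epsilon>-lipschitz_on (ball x \<delta>) (\<lambda>y. s (R y) - A (R y))"
    by (rule lipschitz_on_mono[OF lipschitz_on_compose2[OF lipschitz_on_subset[OF R(1)] lipschitz_on_subset[OF d(2) sub]]])
      (use eta in \<open>auto simp: \<delta>_def\<close>)
  moreover have "0 < \<delta>" using R(2) d L by (simp add: \<delta>_def)
  ultimately show "\<exists>\<delta>>0. \<epsilon>-lipschitz_on (ball x \<delta>) (\<lambda>y. s (R y) - A (R y) - 0)" by auto
qed simp

lemma locally_lipschitz_vec_lambda:
  fixes r :: "'n::finite \<Rightarrow> 'a::metric_space \<Rightarrow> real"
  assumes "\<And>i. \<exists>\<delta>>0. \<exists>L. L-lipschitz_on (ball x \<delta>) (r i)"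
  obtains \<delta> L where "0 < \<delta>" "L-lipschitz_on (ball x \<delta>) (\<lambda>y. \<chi> i. r i y)"
proof -
  obtain d L where d: "\<And>i. 0 < d i" and L: "\<And>i. (L i)-lipschitz_on (ball x (d i)) (r i)"
    using assms by metis
  define \<delta> where "\<delta> = Min (range d)"
  have sub: "ball x \<delta> \<subseteq> ball x (d i)" for i by (intro subset_ball) (simp add: \<delta>_def)
  have "(\<Sum>i\<in>UNIV. L i)-lipschitz_on (ball x \<delta>) (\<lambda>y. \<chi> i. r i y)"
  proof (rule lipschitz_onI)
    fix y z assume yz: "y \<in> ball x \<delta>" "z \<in> ball x \<delta>"
    have "dist (\<chi> i. r i y) (\<chi> i. r i z) \<le> (\<Sum>i\<in>UNIV. \<bar>r i y - r i z\<bar>)"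
      using norm_le_l1_cart[of "(\<chi> i. r i y) - (\<chi> i. r i z)"] by (simp add: dist_norm)
    also have "\<dots> \<le> (\<Sum>i\<in>UNIV. L i * dist y z)"
      using lipschitz_onD[OF L] yz sub by (intro sum_mono) (fastforce simp: dist_real_def)
    finally show "dist (\<chi> i. r i y) (\<chi> i. r i z) \<le> (\<Sum>i\<in>UNIV. L i) * dist y z"
      by (simp add: sum_distrib_right)
  qed (use lipschitz_on_nonneg[OF L] in \<open>simp add: sum_nonneg\<close>)
  moreover have "0 < \<delta>" using d by (simp add: \<delta>_def)
  ultimately show thesis using that by blast
qed

text \<open>The linear part satisfies Jensen's relation with equality, and a remainder with Lipschitz constant
  \<open>\<epsilon> / 2\<close> violates it by at most \<open>\<epsilon> * t * (1 - t) * norm (y - z)\<close>.\<close>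

lemma has_strict_derivative_convexity_defect:
  assumes f: "has_strict_derivative f A x" and e: "0 < \<epsilon>"
  obtains \<delta> where "0 < \<delta>"
    "\<And>y z t. \<lbrakk>y \<in> ball x \<delta>; z \<in> ball x \<delta>; t \<in> {0..1}\<rbrakk> \<Longrightarrow>
      norm (f ((1 - t) *\<^sub>R y + t *\<^sub>R z) - ((1 - t) *\<^sub>R f y + t *\<^sub>R f z)) \<le> \<epsilon> * t * norm (y - z)"
proof -
  obtain \<delta> where d: "0 < \<delta>" "(\<epsilon> / 2)-lipschitz_on (ball x \<delta>) (\<lambda>y. f y - A y)"
    using has_strict_derivativeD[OF f, of "\<epsilon> / 2"] e by auto
  interpret A: bounded_linear A using f by (simp add: has_strict_derivative_def)
  have "norm (f ((1 - t) *\<^sub>R y + t *\<^sub>R z) - ((1 - t) *\<^sub>R f y + t *\<^sub>R f z)) \<le> \<epsilon> * t * norm (y - z)"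
    if yz: "y \<in> ball x \<delta>" "z \<in> ball x \<delta>" and t: "t \<in> {0..1}" for y z t
  proof -
    define p where "p = (1 - t) *\<^sub>R y + t *\<^sub>R z"
    define E where "E = (\<lambda>y. f y - A y)"
    have p: "p \<in> ball x \<delta>"
      unfolding p_def using yz t by (intro convexD[OF convex_ball]) auto
    have py: "p - y = t *\<^sub>R (z - y)" and pz: "p - z = (1 - t) *\<^sub>R (y - z)"
      by (simp_all add: p_def algebra_simps)
    have Ey: "norm (E p - E y) \<le> \<epsilon> / 2 * (t * norm (y - z))"
      using lipschitz_onD[OF d(2) p yz(1)] t
      by (simp add: E_def dist_norm py norm_minus_commute)
    have Ez: "norm (E p - E z) \<le> \<epsilon> / 2 * ((1 - t) * norm (y - z))"
      using lipschitz_onD[OF d(2) p yz(2)] t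
      by (simp add: E_def dist_norm pz)
    have "A p = (1 - t) *\<^sub>R A y + t *\<^sub>R A z" by (simp add: p_def A.add A.scaleR)
    then have "f p - ((1 - t) *\<^sub>R f y + t *\<^sub>R f z) = (1 - t) *\<^sub>R (E p - E y) + t *\<^sub>R (E p - E z)"
      by (simp add: E_def algebra_simps)
    also have "norm \<dots> \<le> (1 - t) * norm (E p - E y) + t * norm (E p - E z)"
      using t by (intro norm_triangle_le) auto
    also have "\<dots> \<le> (1 - t) * (\<epsilon> / 2 * (t * norm (y - z))) + t * (\<epsilon> / 2 * ((1 - t) * norm (y - z)))"
      using t Ey Ez by (intro add_mono mult_left_mono) auto
    also have "\<dots> = (1 - t) * (\<epsilon> * t * norm (y - z))" by (simp add: field_simps)
    also have "\<dots> \<le> 1 * (\<epsilon> * t * norm (y - z))" using t e by (intro mult_right_mono) auto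
    finally show ?thesis by (simp add: p_def)
  qed
  then show thesis using that d(1) by blast
qed

section \<open>Approximate convexity\<close>

text \<open>Convexity up to an error that is of first order in \<open>t\<close> with an arbitrarily small slope. The factor
  \<open>t\<close> is what lets a subgradient inequality be read off as \<open>t\<close> tends to \<open>0\<close>. Bounding \<open>f\<close> by
  real \<open>a\<close> and \<open>b\<close> speaks about points of the epigraph and avoids arithmetic with
  infinite values.\<close>

definition approximately_convex_at :: "('a::real_normed_vector \<Rightarrow> ereal) \<Rightarrow> 'a \<Rightarrow> bool" where
  "approximately_convex_at f x \<longleftrightarrow>
    (\<forall>\<epsilon>>0. \<exists>\<delta>>0. \<forall>y\<in>ball x \<delta>. \<forall>z\<in>ball x \<delta>. \<forall>t\<in>{0..1}. \<forall>a b.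
      f y \<le> ereal a \<longrightarrow> f z \<le> ereal b \<longrightarrow>
      f ((1 - t) *\<^sub>R y + t *\<^sub>R z) \<le> ereal ((1 - t) * a + t * b + \<epsilon> * t * norm (y - z)))"

lemma approximately_convex_atD:
  assumes "approximately_convex_at f x" "0 < \<epsilon>"
  obtains \<delta> where "0 < \<delta>"
    "\<And>y z t a b. \<lbrakk>y \<in> ball x \<delta>; z \<in> ball x \<delta>; t \<in> {0..1}; f y \<le> ereal a; f z \<le> ereal b\<rbrakk> \<Longrightarrow>
      f ((1 - t) *\<^sub>R y + t *\<^sub>R z) \<le> ereal ((1 - t) * a + t * b + \<epsilon> * t * norm (y - z))"
  using assms unfolding approximately_convex_at_def by meson

lemma approximately_convex_at_realI:
  assumes "\<And>\<epsilon>. 0 < \<epsilon> \<Longrightarrow> \<exists>\<delta>>0. \<forall>y\<in>ball x \<delta>. \<forall>z\<in>ball x \<delta>. \<forall>t\<in>{0..1}.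
      f ((1 - t) *\<^sub>R y + t *\<^sub>R z) \<le> (1 - t) * f y + t * f z + \<epsilon> * t * norm (y - z)"
  shows "approximately_convex_at (\<lambda>y. ereal (f y)) x"
  unfolding approximately_convex_at_def
proof (intro allI impI)
  fix \<epsilon> :: real assume "0 < \<epsilon>"
  then obtain \<delta> where d: "0 < \<delta>" "\<forall>y\<in>ball x \<delta>. \<forall>z\<in>ball x \<delta>. \<forall>t\<in>{0..1}.
      f ((1 - t) *\<^sub>R y + t *\<^sub>R z) \<le> (1 - t) * f y + t * f z + \<epsilon> * t * norm (y - z)"
    using assms by blast
  have "f ((1 - t) *\<^sub>R y + t *\<^sub>R z) \<le> (1 - t) * a + t * b + \<epsilon> * t * norm (y - z)"
    if "y \<in> ball x \<delta>" "z \<in> ball x \<delta>" "t \<in> {0..1}" "f y \<le> a" "f z \<le> b" for y z t a b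
  proof -
    have "(1 - t) * f y \<le> (1 - t) * a" "t * f z \<le> t * b"
      using that by (auto intro!: mult_left_mono)
    with d(2) that(1-3) show ?thesis by fastforce
  qed
  with d(1) show "\<exists>\<delta>>0. \<forall>y\<in>ball x \<delta>. \<forall>z\<in>ball x \<delta>. \<forall>t\<in>{0..1}. \<forall>a b.
      ereal (f y) \<le> ereal a \<longrightarrow> ereal (f z) \<le> ereal b \<longrightarrow>
      ereal (f ((1 - t) *\<^sub>R y + t *\<^sub>R z)) \<le> ereal ((1 - t) * a + t * b + \<epsilon> * t * norm (y - z))"
    by auto
qed

lemma convex_fun_iff:
  "convex_fun f \<longleftrightarrow> (\<forall>y z a b. \<forall>t\<in>{0..1}. f y \<le> ereal a \<longrightarrow> f z \<le> ereal b \<longrightarrow>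
      f ((1 - t) *\<^sub>R y + t *\<^sub>R z) \<le> ereal ((1 - t) * a + t * b))"
  unfolding convex_fun_def ereal_epigraph_def convex_alt by fastforce

lemma convex_fun_ereal_iff: "convex_fun (\<lambda>x. ereal (f x)) \<longleftrightarrow> convex_on UNIV f"
proof -
  have "ereal_epigraph (\<lambda>x. ereal (f x)) = epigraph UNIV f"
    by (auto simp: ereal_epigraph_def epigraph_def)
  then show ?thesis by (simp add: convex_fun_def convex_epigraph)
qed

lemma convex_fun_imp_approximately_convex_at:
  assumes "convex_fun f"
  shows "approximately_convex_at f x"
  unfolding approximately_convex_at_def
proof (intro allI impI)
  fix \<epsilon> :: real assume e: "0 < \<epsilon>"
  have "f ((1 - t) *\<^sub>R y + t *\<^sub>R z) \<le> ereal ((1 - t) * a + t * b + \<epsilon> * t * norm (y - z))"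
    if "t \<in> {0..1}" "f y \<le> ereal a" "f z \<le> ereal b" for y z t a b
  proof -
    have "f ((1 - t) *\<^sub>R y + t *\<^sub>R z) \<le> ereal ((1 - t) * a + t * b)"
      using assms that unfolding convex_fun_iff by blast
    also have "\<dots> \<le> ereal ((1 - t) * a + t * b + \<epsilon> * t * norm (y - z))" using that e by simp
    finally show ?thesis .
  qed
  then show "\<exists>\<delta>>0. \<forall>y\<in>ball x \<delta>. \<forall>z\<in>ball x \<delta>. \<forall>t\<in>{0..1}. \<forall>a b.
      f y \<le> ereal a \<longrightarrow> f z \<le> ereal b \<longrightarrow>
      f ((1 - t) *\<^sub>R y + t *\<^sub>R z) \<le> ereal ((1 - t) * a + t * b + \<epsilon> * t * norm (y - z))"
    by (intro exI[of _ 1]) auto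
qed

lemma ereal_add_real_le_iff: "a + ereal b \<le> ereal c \<longleftrightarrow> a \<le> ereal (c - b)"
  by (cases a) auto

lemma approximately_convex_at_add:
  assumes f: "approximately_convex_at f x" and g: "approximately_convex_at (\<lambda>y. ereal (g y)) x"
  shows "approximately_convex_at (\<lambda>y. f y + ereal (g y)) x"
  unfolding approximately_convex_at_def
proof (intro allI impI)
  fix \<epsilon> :: real assume e: "0 < \<epsilon>"
  obtain d1 where d1: "0 < d1"
    "\<And>y z t a b. \<lbrakk>y \<in> ball x d1; z \<in> ball x d1; t \<in> {0..1}; f y \<le> ereal a; f z \<le> ereal b\<rbrakk> \<Longrightarrow>
      f ((1 - t) *\<^sub>R y + t *\<^sub>R z) \<le> ereal ((1 - t) * a + t * b + \<epsilon> / 2 * t * norm (y - z))"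
    using approximately_convex_atD[OF f, of "\<epsilon> / 2"] e by auto
  obtain d2 where d2: "0 < d2"
    "\<And>y z t a b. \<lbrakk>y \<in> ball x d2; z \<in> ball x d2; t \<in> {0..1}; ereal (g y) \<le> ereal a; ereal (g z) \<le> ereal b\<rbrakk> \<Longrightarrow>
      ereal (g ((1 - t) *\<^sub>R y + t *\<^sub>R z)) \<le> ereal ((1 - t) * a + t * b + \<epsilon> / 2 * t * norm (y - z))"
    using approximately_convex_atD[OF g, of "\<epsilon> / 2"] e by auto
  have "f p + ereal (g p) \<le> ereal ((1 - t) * a + t * b + \<epsilon> * t * norm (y - z))"
    if yz: "y \<in> ball x (min d1 d2)" "z \<in> ball x (min d1 d2)" and t: "t \<in> {0..1}"
      and ab: "f y + ereal (g y) \<le> ereal a" "f z + ereal (g z) \<le> ereal b"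
      and p: "p = (1 - t) *\<^sub>R y + t *\<^sub>R z" for y z t a b p
  proof -
    have "f p \<le> ereal ((1 - t) * (a - g y) + t * (b - g z) + \<epsilon> / 2 * t * norm (y - z))"
      unfolding p using yz t ab by (intro d1(2)) (auto simp: ereal_add_real_le_iff)
    moreover have "g p \<le> (1 - t) * g y + t * g z + \<epsilon> / 2 * t * norm (y - z)"
      using d2(2)[of y z t "g y" "g z"] yz t unfolding p by auto
    ultimately show ?thesis
      unfolding ereal_add_real_le_iff by (elim order_trans) (simp add: algebra_simps)
  qed
  then show "\<exists>\<delta>>0. \<forall>y\<in>ball x \<delta>. \<forall>z\<in>ball x \<delta>. \<forall>t\<in>{0..1}. \<forall>a b.
      f y + ereal (g y) \<le> ereal a \<longrightarrow> f z + ereal (g z) \<le> ereal b \<longrightarrow>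
      f ((1 - t) *\<^sub>R y + t *\<^sub>R z) + ereal (g ((1 - t) *\<^sub>R y + t *\<^sub>R z))
        \<le> ereal ((1 - t) * a + t * b + \<epsilon> * t * norm (y - z))"
    using d1(1) d2(1) by (intro exI[of _ "min d1 d2"]) auto
qed

lemma approximately_convex_at_sum:
  fixes x :: "'a::real_normed_vector"
  assumes "finite S" "\<And>i. i \<in> S \<Longrightarrow> approximately_convex_at (\<lambda>y. ereal (f i y)) x"
  shows "approximately_convex_at (\<lambda>y. ereal (\<Sum>i\<in>S. f i y)) x"
  using assms
proof (induction S rule: finite_induct)
  case empty
  have "convex_fun (\<lambda>_::'a. ereal 0)" by (simp add: convex_fun_iff)
  then show ?case by (simp add: convex_fun_imp_approximately_convex_at)
next
  case (insert i S)
  then have "approximately_convex_at (\<lambda>y. ereal (f i y) + ereal (\<Sum>i\<in>S. f i y)) x"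
    by (intro approximately_convex_at_add) auto
  then show ?case using insert.hyps by simp
qed

text \<open>Strict differentiability is invariant under negation, so a strictly differentiable \<open>r i\<close> may enter
  with a coefficient of either sign.\<close>

lemma has_strict_derivative_imp_approximately_convex_at:
  fixes f :: "'a::real_normed_vector \<Rightarrow> real"
  assumes "has_strict_derivative f A x"
  shows "approximately_convex_at (\<lambda>y. ereal (f y)) x"
proof (rule approximately_convex_at_realI)
  fix \<epsilon> :: real assume "0 < \<epsilon>"
  then obtain \<delta> where "0 < \<delta>"
    "\<And>y z t. \<lbrakk>y \<in> ball x \<delta>; z \<in> ball x \<delta>; t \<in> {0..1}\<rbrakk> \<Longrightarrow>
      norm (f ((1 - t) *\<^sub>R y + t *\<^sub>R z) - ((1 - t) *\<^sub>R f y + t *\<^sub>R f z)) \<le> \<epsilon> * t * norm (y - z)"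
    using has_strict_derivative_convexity_defect[OF assms] by blast
  then show "\<exists>\<delta>>0. \<forall>y\<in>ball x \<delta>. \<forall>z\<in>ball x \<delta>. \<forall>t\<in>{0..1}.
      f ((1 - t) *\<^sub>R y + t *\<^sub>R z) \<le> (1 - t) * f y + t * f z + \<epsilon> * t * norm (y - z)"
    by (fastforce simp: abs_le_iff)
qed

text \<open>Near \<open>x\<close> the map \<open>C\<close> almost respects convex combinations, and the Lipschitz function \<open>h\<close> turns
  the defect of \<open>C\<close> into a proportional error. Convexity of \<open>h\<close> takes care of the exact convex
  combination of \<open>C y\<close> and \<open>C z\<close>.\<close>

lemma approximately_convex_at_convex_compose:
  fixes h :: "'b::euclidean_space \<Rightarrow> real"
  assumes h: "convex_on UNIV h" and C: "has_strict_derivative C A x"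
  shows "approximately_convex_at (\<lambda>y. ereal (h (C y))) x"
proof (rule approximately_convex_at_realI)
  fix \<epsilon> :: real assume e: "0 < \<epsilon>"
  obtain \<rho> L where L: "0 < \<rho>" "L-lipschitz_on (ball (C x) \<rho>) h"
    using convex_on_UNIV_locally_lipschitz[OF h] .
  have L0: "0 \<le> L" using L(2) by (rule lipschitz_on_nonneg)
  have "isCont C x"
    using has_strict_derivative_imp_has_derivative[OF C] by (rule has_derivative_continuous)
  then obtain d1 where d1: "0 < d1" "\<And>y. y \<in> ball x d1 \<Longrightarrow> C y \<in> ball (C x) \<rho>"
    using L(1) unfolding continuous_at_eps_delta by (metis dist_commute dist_norm mem_ball)
  define \<eta> where "\<eta> = \<epsilon> / (1 + L)"
  have eta: "0 < \<eta>" "L * \<eta> \<le> \<epsilon>" using e L0 by (auto simp: \<eta>_def field_simps)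
  obtain d2 where d2: "0 < d2"
    "\<And>y z t. \<lbrakk>y \<in> ball x d2; z \<in> ball x d2; t \<in> {0..1}\<rbrakk> \<Longrightarrow>
      norm (C ((1 - t) *\<^sub>R y + t *\<^sub>R z) - ((1 - t) *\<^sub>R C y + t *\<^sub>R C z)) \<le> \<eta> * t * norm (y - z)"
    using has_strict_derivative_convexity_defect[OF C eta(1)] by blast
  have "h (C p) \<le> (1 - t) * h (C y) + t * h (C z) + \<epsilon> * t * norm (y - z)"
    if yz: "y \<in> ball x (min d1 d2)" "z \<in> ball x (min d1 d2)" and t: "t \<in> {0..1}"
      and p_def: "p = (1 - t) *\<^sub>R y + t *\<^sub>R z" for y z t p
  proof -
    define q where "q = (1 - t) *\<^sub>R C y + t *\<^sub>R C z"
    have "p \<in> ball x (min d1 d2)"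
      unfolding p_def using yz t by (intro convexD[OF convex_ball]) auto
    then have p: "C p \<in> ball (C x) \<rho>" by (intro d1(2)) auto
    have q: "q \<in> ball (C x) \<rho>"
      unfolding q_def using yz t by (intro convexD[OF convex_ball] d1(2)) auto
    have "h (C p) - h q \<le> L * norm (C p - q)"
      using lipschitz_onD[OF L(2) p q] by (simp add: dist_norm abs_le_iff)
    also have "\<dots> \<le> L * (\<eta> * t * norm (y - z))"
      unfolding p_def q_def using yz t L0 by (intro mult_left_mono d2(2)) auto
    also have "\<dots> = L * \<eta> * (t * norm (y - z))" by simp
    also have "\<dots> \<le> \<epsilon> * (t * norm (y - z))" using t eta by (intro mult_right_mono) auto
    finally have "h (C p) \<le> h q + \<epsilon> * t * norm (y - z)" by simp
    moreover have "h q \<le> (1 - t) * h (C y) + t * h (C z)"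
      unfolding q_def by (rule convex_onD[OF h]) (use t in auto)
    ultimately show ?thesis by simp
  qed
  then show "\<exists>\<delta>>0. \<forall>y\<in>ball x \<delta>. \<forall>z\<in>ball x \<delta>. \<forall>t\<in>{0..1}.
      h (C ((1 - t) *\<^sub>R y + t *\<^sub>R z)) \<le> (1 - t) * h (C y) + t * h (C z) + \<epsilon> * t * norm (y - z)"
    using d1(1) d2(1) by (intro exI[of _ "min d1 d2"]) auto
qed

section \<open>Regularity of approximately convex functions\<close>

lemma regular_normal_cone_iff:
  "v \<in> regular_normal_cone S x \<longleftrightarrow>
    x \<in> S \<and> (\<forall>\<epsilon>>0. \<exists>\<delta>>0. \<forall>y\<in>S. dist y x < \<delta> \<longrightarrow> v \<bullet> (y - x) \<le> \<epsilon> * norm (y - x))"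
  (is "_ \<longleftrightarrow> _ \<and> ?R")
proof -
  have "Limsup (at x within S) (\<lambda>y. ereal (v \<bullet> (y - x) / norm (y - x))) \<le> 0 \<longleftrightarrow> ?R"
  proof
    assume L: "Limsup (at x within S) (\<lambda>y. ereal (v \<bullet> (y - x) / norm (y - x))) \<le> 0"
    show ?R
    proof (intro allI impI)
      fix \<epsilon> :: real assume "0 < \<epsilon>"
      then have "\<forall>\<^sub>F y in at x within S. ereal (v \<bullet> (y - x) / norm (y - x)) < ereal \<epsilon>"
        using L[unfolded Limsup_le_iff, rule_format, of "ereal \<epsilon>"] by simp
      then obtain \<delta> where d: "0 < \<delta>"
        "\<And>y. y \<in> S \<Longrightarrow> y \<noteq> x \<Longrightarrow> dist y x < \<delta> \<Longrightarrow> v \<bullet> (y - x) / norm (y - x) < \<epsilon>"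
        unfolding eventually_at by auto
      have "v \<bullet> (y - x) \<le> \<epsilon> * norm (y - x)" if "y \<in> S" "dist y x < \<delta>" for y
        using d(2)[of y] that by (cases "y = x") (auto simp: divide_less_eq)
      then show "\<exists>\<delta>>0. \<forall>y\<in>S. dist y x < \<delta> \<longrightarrow> v \<bullet> (y - x) \<le> \<epsilon> * norm (y - x)"
        using d(1) by blast
    qed
  next
    assume R: ?R
    show "Limsup (at x within S) (\<lambda>y. ereal (v \<bullet> (y - x) / norm (y - x))) \<le> 0"
      unfolding Limsup_le_iff
    proof (intro allI impI)
      fix c :: ereal assume "0 < c"
      then obtain \<epsilon> where e: "0 < \<epsilon>" "ereal \<epsilon> < c"
        using ereal_dense2[of 0 c] by auto
      then obtain \<delta> where d: "0 < \<delta>"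
        "\<And>y. y \<in> S \<Longrightarrow> dist y x < \<delta> \<Longrightarrow> v \<bullet> (y - x) \<le> \<epsilon> * norm (y - x)"
        using R by blast
      have "ereal (v \<bullet> (y - x) / norm (y - x)) < c" if "y \<in> S" "y \<noteq> x" "dist y x < \<delta>" for y
      proof -
        have "v \<bullet> (y - x) / norm (y - x) \<le> \<epsilon>"
          using d(2)[of y] that by (simp add: divide_le_eq)
        with e(2) show ?thesis by (metis ereal_less_eq(3) le_less_trans)
      qed
      then show "\<forall>\<^sub>F y in at x within S. ereal (v \<bullet> (y - x) / norm (y - x)) < c"
        using d(1) unfolding eventually_at by blast
    qed
  qed
  then show ?thesis by (simp add: regular_normal_cone_def)
qed

lemma frechet_subdifferential_iff:
  "v \<in> frechet_subdifferential f x \<longleftrightarrow>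
    \<bar>f x\<bar> \<noteq> \<infinity> \<and>
    (\<forall>\<epsilon>>0. \<exists>\<delta>>0. \<forall>y\<in>ball x \<delta>. f x + ereal (v \<bullet> (y - x) - \<epsilon> * norm (y - x)) \<le> f y)"
  (is "_ \<longleftrightarrow> _ \<and> ?R")
proof (cases "\<bar>f x\<bar> = \<infinity>")
  case False
  define Q where "Q = (\<lambda>y. (f y - f x - ereal (v \<bullet> (y - x))) / ereal (norm (y - x)))"
  have Q: "ereal (- \<epsilon>) \<le> Q y \<longleftrightarrow> f x + ereal (v \<bullet> (y - x) - \<epsilon> * norm (y - x)) \<le> f y"
    if "y \<noteq> x" for \<epsilon> y
  proof -
    have n: "0 < norm (y - x)" using that by simp
    obtain a where a: "f x = ereal a" using False by (cases "f x") auto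
    show ?thesis
      by (cases "f y") (use n a in \<open>auto simp: Q_def field_simps\<close>)
  qed
  have "0 \<le> Liminf (at x) Q \<longleftrightarrow> ?R"
  proof
    assume L: "0 \<le> Liminf (at x) Q"
    show ?R
    proof (intro allI impI)
      fix \<epsilon> :: real assume "0 < \<epsilon>"
      then have "\<forall>\<^sub>F y in at x. ereal (- \<epsilon>) < Q y"
        using L[unfolded le_Liminf_iff, rule_format, of "ereal (- \<epsilon>)"] by simp
      then obtain \<delta> where d: "0 < \<delta>" "\<And>y. y \<noteq> x \<Longrightarrow> dist y x < \<delta> \<Longrightarrow> ereal (- \<epsilon>) < Q y"
        unfolding eventually_at by auto
      have "f x + ereal (v \<bullet> (y - x) - \<epsilon> * norm (y - x)) \<le> f y" if "y \<in> ball x \<delta>" for y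
      proof (cases "y = x")
        case True
        then show ?thesis by (simp flip: zero_ereal_def)
      next
        case neq: False
        then show ?thesis
          using d(2)[of y] that Q[OF neq, of \<epsilon>] by (simp add: dist_commute less_imp_le)
      qed
      then show "\<exists>\<delta>>0. \<forall>y\<in>ball x \<delta>. f x + ereal (v \<bullet> (y - x) - \<epsilon> * norm (y - x)) \<le> f y"
        using d(1) by blast
    qed
  next
    assume R: ?R
    show "0 \<le> Liminf (at x) Q"
      unfolding le_Liminf_iff
    proof (intro allI impI)
      fix c :: ereal assume "c < 0"
      then obtain e where e: "e < 0" "c < ereal e"
        using ereal_dense2[of c 0] by auto
      then obtain \<delta> where d: "0 < \<delta>"
        "\<And>y. y \<in> ball x \<delta> \<Longrightarrow> f x + ereal (v \<bullet> (y - x) - (- e) * norm (y - x)) \<le> f y"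
        using R[rule_format, of "- e"] by auto
      have "c < Q y" if "y \<noteq> x" "dist y x < \<delta>" for y
        using Q[OF that(1), of "- e"] d(2)[of y] that e(2) by (auto simp: dist_commute)
      then show "\<forall>\<^sub>F y in at x. c < Q y"
        using d(1) unfolding eventually_at by blast
    qed
  qed
  then show ?thesis using False by (simp add: frechet_subdifferential_def Q_def)
qed (simp add: frechet_subdifferential_def)

text \<open>A regular normal makes no acute angle with a segment that starts at the base point and stays
  in the set. This is how a first-order condition at a point turns into an inequality at a distance.\<close>

lemma regular_normal_cone_segment:
  assumes v: "v \<in> regular_normal_cone S x"
    and seg: "\<And>t. 0 < t \<Longrightarrow> t \<le> 1 \<Longrightarrow> x + t *\<^sub>R d \<in> S"
  shows "v \<bullet> d \<le> 0"
proof (rule ccontr)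
  assume "\<not> v \<bullet> d \<le> 0"
  then have pos: "0 < v \<bullet> d" by simp
  then have d: "0 < norm d" by auto
  obtain \<delta> where \<delta>: "0 < \<delta>" "\<And>y. y \<in> S \<Longrightarrow> dist y x < \<delta> \<Longrightarrow>
      v \<bullet> (y - x) \<le> v \<bullet> d / (2 * norm d) * norm (y - x)"
    using v[unfolded regular_normal_cone_iff, THEN conjunct2, rule_format, of "v \<bullet> d / (2 * norm d)"] pos d
    by auto
  define t where "t = min 1 (\<delta> / (2 * norm d))"
  have t: "0 < t" "t \<le> 1" "t * norm d < \<delta>"
    using \<delta>(1) d by (auto simp: t_def min_def field_simps)
  have "v \<bullet> (t *\<^sub>R d) \<le> v \<bullet> d / (2 * norm d) * norm (t *\<^sub>R d)"
    using \<delta>(2)[OF seg[OF t(1,2)]] t by (simp add: dist_norm)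
  then have "t * (v \<bullet> d) \<le> t * (v \<bullet> d) / 2" using d t by (simp add: field_simps)
  with t pos show False by (simp add: field_simps)
qed

lemma frechet_subgradient_imp_regular_normal:
  assumes v: "v \<in> frechet_subdifferential f x" and a: "f x = ereal a"
  shows "(v, - 1) \<in> regular_normal_cone (ereal_epigraph f) (x, a)"
  unfolding regular_normal_cone_iff
proof (intro conjI allI impI)
  show "(x, a) \<in> ereal_epigraph f" by (simp add: ereal_epigraph_def a)
  fix \<epsilon> :: real assume e: "0 < \<epsilon>"
  then obtain \<delta> where d: "0 < \<delta>"
    "\<And>y. y \<in> ball x \<delta> \<Longrightarrow> f x + ereal (v \<bullet> (y - x) - \<epsilon> * norm (y - x)) \<le> f y"
    using v unfolding frechet_subdifferential_iff by blast
  have "(v, - 1) \<bullet> ((y, b) - (x, a)) \<le> \<epsilon> * norm ((y, b) - (x, a))"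
    if yb: "(y, b) \<in> ereal_epigraph f" "dist (y, b) (x, a) < \<delta>" for y b
  proof -
    have "dist y x < \<delta>" using yb(2) dist_fst_le[of "(y, b)" "(x, a)"] by simp
    then have "f x + ereal (v \<bullet> (y - x) - \<epsilon> * norm (y - x)) \<le> ereal b"
      using d(2)[of y] yb(1) by (auto simp: dist_commute ereal_epigraph_def)
    then have "v \<bullet> (y - x) - (b - a) \<le> \<epsilon> * norm (y - x)" by (simp add: a)
    also have "\<dots> \<le> \<epsilon> * norm ((y, b) - (x, a))"
      using e norm_fst_le[of "y - x" "b - a"] by (intro mult_left_mono) auto
    finally show ?thesis by simp
  qed
  then show "\<exists>\<delta>>0. \<forall>p\<in>ereal_epigraph f. dist p (x, a) < \<delta> \<longrightarrow>
      (v, - 1) \<bullet> (p - (x, a)) \<le> \<epsilon> * norm (p - (x, a))"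
    using d(1) by (intro exI[of _ \<delta>]) auto
qed

text \<open>The segment from \<open>(x, f x)\<close> to any point of a convex epigraph stays in it, so the local normal
  \<open>(v, -1)\<close> gives the global inequality.\<close>

lemma frechet_subdifferential_convex:
  assumes f: "convex_fun f"
  shows "frechet_subdifferential f x = convex_subdifferential f x"
proof (intro equalityI subsetI)
  fix v assume v: "v \<in> frechet_subdifferential f x"
  then have fin: "\<bar>f x\<bar> \<noteq> \<infinity>" by (simp add: frechet_subdifferential_def)
  then obtain a where a: "f x = ereal a" by (cases "f x") auto
  note n = frechet_subgradient_imp_regular_normal[OF v a]
  have ineq: "a + v \<bullet> (y - x) \<le> b" if b: "f y \<le> ereal b" for y b
  proof -
    have "(v, - 1) \<bullet> (y - x, b - a) \<le> 0"
    proof (rule regular_normal_cone_segment[OF n])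
      fix t :: real assume t: "0 < t" "t \<le> 1"
      have "f ((1 - t) *\<^sub>R x + t *\<^sub>R y) \<le> ereal ((1 - t) * a + t * b)"
        using f t b a unfolding convex_fun_iff by auto
      then show "(x, a) + t *\<^sub>R (y - x, b - a) \<in> ereal_epigraph f"
        by (simp add: ereal_epigraph_def algebra_simps)
    qed
    then show ?thesis by simp
  qed
  have "f x + ereal (v \<bullet> (y - x)) \<le> f y" for y
    by (rule ereal_le_real) (use ineq in \<open>auto simp: a\<close>)
  with fin show "v \<in> convex_subdifferential f x" by (simp add: convex_subdifferential_def)
next
  fix v assume v: "v \<in> convex_subdifferential f x"
  then have le: "f x + ereal (v \<bullet> (y - x)) \<le> f y" for y by (simp add: convex_subdifferential_def)
  have "f x + ereal (v \<bullet> (y - x) - \<epsilon> * norm (y - x)) \<le> f y" if "0 < \<epsilon>" for \<epsilon> y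
    by (rule order_trans[OF _ le]) (use that in \<open>auto intro!: add_mono\<close>)
  with v show "v \<in> frechet_subdifferential f x"
    unfolding frechet_subdifferential_iff by (auto simp: convex_subdifferential_def intro: exI[of _ 1])
qed

text \<open>Approximate convexity bounds the error of the convex subgradient inequality uniformly over
  nearby base points, so the inequality survives the passage to the limit that defines limiting
  normals.\<close>

lemma limiting_normal_inequality:
  assumes f: "approximately_convex_at f x"
    and n: "(v, m) \<in> limiting_normal_cone (ereal_epigraph f) (x, a)"
    and e: "0 < \<epsilon>"
  obtains \<delta> where "0 < \<delta>"
    "\<And>y b. y \<in> ball x \<delta> \<Longrightarrow> f y \<le> ereal b \<Longrightarrow>
      v \<bullet> (y - x) + m * (b - a) \<le> \<bar>m\<bar> * \<epsilon> * norm (y - x)"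
proof -
  obtain p w where p: "\<And>k. p k \<in> ereal_epigraph f" "p \<longlonglongrightarrow> (x, a)"
    and w: "\<And>k. w k \<in> regular_normal_cone (ereal_epigraph f) (p k)" "w \<longlonglongrightarrow> (v, m)"
    using n unfolding limiting_normal_cone_def by blast
  obtain \<delta> where d: "0 < \<delta>"
    "\<And>y z t a b. \<lbrakk>y \<in> ball x \<delta>; z \<in> ball x \<delta>; t \<in> {0..1}; f y \<le> ereal a; f z \<le> ereal b\<rbrakk> \<Longrightarrow>
      f ((1 - t) *\<^sub>R y + t *\<^sub>R z) \<le> ereal ((1 - t) * a + t * b + \<epsilon> * t * norm (y - z))"
    using approximately_convex_atD[OF f e] by blast
  have fp: "f (fst (p k)) \<le> ereal (snd (p k))" for k
    using p(1)[of k] by (auto simp: ereal_epigraph_def)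
  have limits: "(\<lambda>k. fst (p k)) \<longlonglongrightarrow> x" "(\<lambda>k. snd (p k)) \<longlonglongrightarrow> a"
    "(\<lambda>k. fst (w k)) \<longlonglongrightarrow> v" "(\<lambda>k. snd (w k)) \<longlonglongrightarrow> m"
    using tendsto_fst[OF p(2)] tendsto_snd[OF p(2)] tendsto_fst[OF w(2)] tendsto_snd[OF w(2)] by auto
  have down: "snd (w k) \<le> 0" for k
  proof -
    have "w k \<bullet> (0, 1) \<le> 0"
    proof (rule regular_normal_cone_segment[OF w(1)])
      fix t :: real assume "0 < t"
      then have "f (fst (p k)) \<le> ereal (snd (p k) + t)"
        by (intro order_trans[OF fp]) auto
      then show "p k + t *\<^sub>R (0, 1) \<in> ereal_epigraph f"
        by (cases "p k") (simp add: ereal_epigraph_def)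
    qed
    then show ?thesis by (cases "w k") simp
  qed
  have "v \<bullet> (y - x) + m * (b - a) \<le> \<bar>m\<bar> * \<epsilon> * norm (y - x)"
    if y: "y \<in> ball x \<delta>" "f y \<le> ereal b" for y b
  proof (rule LIMSEQ_le)
    show "(\<lambda>k. fst (w k) \<bullet> (y - fst (p k)) + snd (w k) * (b - snd (p k)))
        \<longlonglongrightarrow> v \<bullet> (y - x) + m * (b - a)"
      by (intro tendsto_intros limits)
    show "(\<lambda>k. \<bar>snd (w k)\<bar> * \<epsilon> * norm (y - fst (p k))) \<longlonglongrightarrow> \<bar>m\<bar> * \<epsilon> * norm (y - x)"
      by (intro tendsto_intros limits)
    have "\<forall>\<^sub>F k in sequentially. fst (p k) \<in> ball x \<delta>"
      using limits(1) d(1) by (intro topological_tendstoD) auto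
    then have "\<forall>\<^sub>F k in sequentially. fst (w k) \<bullet> (y - fst (p k)) + snd (w k) * (b - snd (p k))
        \<le> \<bar>snd (w k)\<bar> * \<epsilon> * norm (y - fst (p k))"
    proof eventually_elim
      case (elim k)
      define z where "z = fst (p k)"
      define c where "c = snd (p k)"
      \<comment> \<open>Lifting the chord to \<open>(y, b)\<close> by the convexity error keeps it in the epigraph.\<close>
      have "w k \<bullet> (y - z, b - c + \<epsilon> * norm (z - y)) \<le> 0"
      proof (rule regular_normal_cone_segment[OF w(1)])
        fix t :: real assume t: "0 < t" "t \<le> 1"
        have "f ((1 - t) *\<^sub>R z + t *\<^sub>R y) \<le> ereal ((1 - t) * c + t * b + \<epsilon> * t * norm (z - y))"
          using t elim y fp by (intro d(2)) (auto simp: z_def c_def)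
        moreover have "p k = (z, c)" by (simp add: z_def c_def)
        ultimately show "p k + t *\<^sub>R (y - z, b - c + \<epsilon> * norm (z - y)) \<in> ereal_epigraph f"
          by (simp add: ereal_epigraph_def algebra_simps)
      qed
      moreover have "w k = (fst (w k), snd (w k))" by simp
      ultimately have "fst (w k) \<bullet> (y - z) + snd (w k) * (b - c + \<epsilon> * norm (z - y)) \<le> 0"
        by (metis inner_Pair inner_real_def)
      with down[of k] show ?case
        by (simp add: z_def c_def algebra_simps norm_minus_commute)
    qed
    then show "\<exists>N. \<forall>k\<ge>N. fst (w k) \<bullet> (y - fst (p k)) + snd (w k) * (b - snd (p k))
        \<le> \<bar>snd (w k)\<bar> * \<epsilon> * norm (y - fst (p k))"
      by (simp add: eventually_sequentially)
  qed
  with d(1) show thesis by (rule that)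
qed

text \<open>At a normal \<open>(v, m)\<close> the uniform inequality carries the error \<open>\<bar>m\<bar> * \<epsilon>\<close>, and \<open>m\<close> is fixed
  while \<open>\<epsilon>\<close> is free. Horizontal normals (\<open>m = 0\<close>) carry no error.\<close>

lemma clarke_regular_at_epigraph:
  assumes f: "approximately_convex_at f x" and cl: "closed (ereal_epigraph f)"
    and a: "f x \<le> ereal a"
  shows "clarke_regular_at (ereal_epigraph f) (x, a)"
proof -
  have mem: "(x, a) \<in> ereal_epigraph f" using a by (simp add: ereal_epigraph_def)
  have "locally_closed_at (ereal_epigraph f) (x, a)"
    unfolding locally_closed_at_def using cl by (intro exI[of _ UNIV]) auto
  moreover have "limiting_normal_cone (ereal_epigraph f) (x, a) = regular_normal_cone (ereal_epigraph f) (x, a)"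
  proof (intro equalityI subsetI)
    fix w assume w: "w \<in> limiting_normal_cone (ereal_epigraph f) (x, a)"
    obtain v m where vm: "w = (v, m)" by (cases w)
    show "w \<in> regular_normal_cone (ereal_epigraph f) (x, a)"
      unfolding regular_normal_cone_iff
    proof (intro conjI allI impI mem)
      fix \<epsilon> :: real assume e: "0 < \<epsilon>"
      define \<eta> where "\<eta> = \<epsilon> / (1 + \<bar>m\<bar>)"
      have eta: "0 < \<eta>" "\<bar>m\<bar> * \<eta> \<le> \<epsilon>" using e by (auto simp: \<eta>_def field_simps)
      obtain \<delta> where d: "0 < \<delta>"
        "\<And>y b. y \<in> ball x \<delta> \<Longrightarrow> f y \<le> ereal b \<Longrightarrow>
          v \<bullet> (y - x) + m * (b - a) \<le> \<bar>m\<bar> * \<eta> * norm (y - x)"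
        using limiting_normal_inequality[OF f _ eta(1)] w vm by blast
      have "(v, m) \<bullet> ((y, b) - (x, a)) \<le> \<epsilon> * norm ((y, b) - (x, a))"
        if yb: "(y, b) \<in> ereal_epigraph f" "dist (y, b) (x, a) < \<delta>" for y b
      proof -
        have "dist y x < \<delta>" using yb(2) dist_fst_le[of "(y, b)" "(x, a)"] by simp
        then have "v \<bullet> (y - x) + m * (b - a) \<le> \<bar>m\<bar> * \<eta> * norm (y - x)"
          using yb(1) by (intro d(2)) (auto simp: dist_commute ereal_epigraph_def)
        also have "\<dots> \<le> \<epsilon> * norm ((y, b) - (x, a))"
          using e eta norm_fst_le[of "y - x" "b - a"] by (intro mult_mono) auto
        finally show ?thesis by simp
      qed
      then show "\<exists>\<delta>>0. \<forall>p\<in>ereal_epigraph f. dist p (x, a) < \<delta> \<longrightarrow>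
          w \<bullet> (p - (x, a)) \<le> \<epsilon> * norm (p - (x, a))"
        using d(1) vm by (intro exI[of _ \<delta>]) auto
    qed
  next
    fix w assume w: "w \<in> regular_normal_cone (ereal_epigraph f) (x, a)"
    show "w \<in> limiting_normal_cone (ereal_epigraph f) (x, a)"
      unfolding limiting_normal_cone_def
      by (intro CollectI conjI mem, rule exI[of _ "\<lambda>_. (x, a)"], rule exI[of _ "\<lambda>_. w"]) (simp add: mem w)
  qed
  ultimately show ?thesis using mem by (simp add: clarke_regular_at_def)
qed

lemma limiting_subgradient_imp_limiting_normal:
  assumes v: "v \<in> limiting_subdifferential f x" and a: "f x = ereal a"
  shows "(v, - 1) \<in> limiting_normal_cone (ereal_epigraph f) (x, a)"
proof -
  obtain y w where y: "y \<longlonglongrightarrow> x" "(\<lambda>k. f (y k)) \<longlonglongrightarrow> f x"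
    and w: "\<And>k. w k \<in> frechet_subdifferential f (y k)" "w \<longlonglongrightarrow> v"
    using v unfolding limiting_subdifferential_def by blast
  define b where "b = (\<lambda>k. real_of_ereal (f (y k)))"
  have fin: "\<bar>f (y k)\<bar> \<noteq> \<infinity>" for k using w(1)[of k] by (simp add: frechet_subdifferential_def)
  then have b: "f (y k) = ereal (b k)" for k by (simp add: b_def ereal_real)
  have "b \<longlonglongrightarrow> a" using y(2) unfolding b a by simp
  then have "(\<lambda>k. (y k, b k)) \<longlonglongrightarrow> (x, a)" "(\<lambda>k. (w k, - 1 :: real)) \<longlonglongrightarrow> (v, - 1)"
    using y(1) w(2) by (auto intro!: tendsto_intros)
  moreover have "(y k, b k) \<in> ereal_epigraph f" for k by (simp add: ereal_epigraph_def b)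
  moreover have "(w k, - 1) \<in> regular_normal_cone (ereal_epigraph f) (y k, b k)" for k
    by (rule frechet_subgradient_imp_regular_normal[OF w(1) b])
  moreover have "(x, a) \<in> ereal_epigraph f" by (simp add: ereal_epigraph_def a)
  ultimately show ?thesis
    unfolding limiting_normal_cone_def
    by (intro CollectI conjI exI[of _ "\<lambda>k. (y k, b k)"] exI[of _ "\<lambda>k. (w k, - 1)"]) auto
qed

text \<open>Passing from subgradients to normals with last component \<open>-1\<close> lets the inequality for limiting
  normals serve here too; with \<open>m = -1\<close> it is the definition of a Frechet subgradient.\<close>

lemma limiting_subdifferential_approximately_convex:
  assumes f: "approximately_convex_at f x"
  shows "limiting_subdifferential f x = frechet_subdifferential f x"
proof (intro equalityI subsetI)
  fix v assume v: "v \<in> limiting_subdifferential f x"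
  then have fin: "\<bar>f x\<bar> \<noteq> \<infinity>" by (simp add: limiting_subdifferential_def)
  then obtain a where a: "f x = ereal a" by (cases "f x") auto
  note n = limiting_subgradient_imp_limiting_normal[OF v a]
  show "v \<in> frechet_subdifferential f x"
    unfolding frechet_subdifferential_iff
  proof (intro conjI allI impI fin)
    fix \<epsilon> :: real assume e: "0 < \<epsilon>"
    obtain \<delta> where d: "0 < \<delta>"
      "\<And>y b. y \<in> ball x \<delta> \<Longrightarrow> f y \<le> ereal b \<Longrightarrow>
        v \<bullet> (y - x) + (- 1) * (b - a) \<le> \<bar>- 1\<bar> * \<epsilon> * norm (y - x)"
      by (rule limiting_normal_inequality[OF f n e], rule that)
    have "f x + ereal (v \<bullet> (y - x) - \<epsilon> * norm (y - x)) \<le> ereal b"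
      if "y \<in> ball x \<delta>" "f y \<le> ereal b" for y b
      using d(2)[OF that] by (simp add: a)
    then have "f x + ereal (v \<bullet> (y - x) - \<epsilon> * norm (y - x)) \<le> f y" if "y \<in> ball x \<delta>" for y
      by (rule ereal_le_real) (use that in blast)
    with d(1) show "\<exists>\<delta>>0. \<forall>y\<in>ball x \<delta>. f x + ereal (v \<bullet> (y - x) - \<epsilon> * norm (y - x)) \<le> f y"
      by blast
  qed
next
  fix v assume v: "v \<in> frechet_subdifferential f x"
  then have "\<bar>f x\<bar> \<noteq> \<infinity>" by (simp add: frechet_subdifferential_def)
  then show "v \<in> limiting_subdifferential f x"
    unfolding limiting_subdifferential_def
    by (intro CollectI conjI, assumption)
      (rule exI[of _ "\<lambda>_. x"], rule exI[of _ "\<lambda>_. v"], simp add: v)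
qed

section \<open>Calculus of convex subdifferentials\<close>

lemma convex_subdifferential_real:
  "v \<in> convex_subdifferential (\<lambda>y. ereal (f y)) x \<longleftrightarrow> (\<forall>y. f x + v \<bullet> (y - x) \<le> f y)"
  by (simp add: convex_subdifferential_def)

text \<open>The Moreau--Rockafellar theorem together with the chain rule for an affine inner map. The
  subgradient inequality for the sum bounds \<open>h (b + J y)\<close> below by an expression in \<open>y\<close> and \<open>g y\<close>.
  It says that the strict epigraph of \<open>h\<close> misses the set of points \<open>(b + J y, c)\<close> with \<open>c\<close> at
  most this bound, and both sets are convex. A separating hyperplane is the graph of an affine function
  whose slope \<open>w\<close> splits \<open>v\<close>.
  Finiteness of \<open>h\<close> is the constraint qualification: it rules out a vertical hyperplane.\<close>

lemma convex_subgradient_split: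
  fixes g :: "'a::euclidean_space \<Rightarrow> ereal" and h :: "'b::euclidean_space \<Rightarrow> real"
  assumes g: "convex_fun g" and h: "convex_on UNIV h" and J: "linear J"
    and v: "v \<in> convex_subdifferential (\<lambda>y. g y + ereal (h (b + J y))) x"
  obtains w where "w \<in> convex_subdifferential (\<lambda>u. ereal (h u)) (b + J x)"
    "v - adjoint J w \<in> convex_subdifferential g x"
proof -
  have fin: "\<bar>g x\<bar> \<noteq> \<infinity>"
    and sub: "g x + ereal (h (b + J x)) + ereal (v \<bullet> (y - x)) \<le> g y + ereal (h (b + J y))" for y
    using v by (auto simp: convex_subdifferential_def)
  obtain \<gamma> where \<gamma>: "g x = ereal \<gamma>" using fin by (cases "g x") auto
  define \<eta> where "\<eta> = h (b + J x)"
  have sub': "\<gamma> + \<eta> + v \<bullet> (y - x) \<le> \<beta> + h (b + J y)" if "g y \<le> ereal \<beta>" for y \<beta>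
  proof -
    have "g y + ereal (h (b + J y)) \<le> ereal \<beta> + ereal (h (b + J y))"
      using that by (rule add_right_mono)
    from order_trans[OF sub this] show ?thesis by (simp add: \<gamma> \<eta>_def)
  qed
  define P where "P = {(u, a). h u < a}"
  define A where "A = (\<lambda>(y, \<beta>). (b + J y, \<eta> + \<gamma> + v \<bullet> (y - x) - \<beta>))"
  define Q where "Q = A ` ereal_epigraph g"
  have "convex P"
    unfolding convex_alt
  proof (intro ballI allI impI)
    fix p q and t :: real
    assume p: "p \<in> P" and q: "q \<in> P" and t: "0 \<le> t \<and> t \<le> 1"
    obtain u a u' a' where pq: "p = (u, a)" "q = (u', a')" by (cases p, cases q)
    have "h ((1 - t) *\<^sub>R u + t *\<^sub>R u') \<le> (1 - t) * h u + t * h u'"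
      by (rule convex_onD[OF h]) (use t in auto)
    also have "\<dots> < (1 - t) * a + t * a'"
    proof (cases "t = 0")
      case False
      then have "t * h u' < t * a'" using t q pq by (simp add: P_def)
      moreover have "(1 - t) * h u \<le> (1 - t) * a"
        using t p pq by (intro mult_left_mono) (auto simp: P_def)
      ultimately show ?thesis by simp
    qed (use p pq in \<open>simp add: P_def\<close>)
    finally show "(1 - t) *\<^sub>R p + t *\<^sub>R q \<in> P" by (simp add: P_def pq)
  qed
  moreover have "convex Q"
    unfolding convex_alt
  proof (intro ballI allI impI)
    fix p q and t :: real
    assume p: "p \<in> Q" and q: "q \<in> Q" and t: "0 \<le> t \<and> t \<le> 1"
    obtain p' q' where pq: "p = A p'" "q = A q'" "p' \<in> ereal_epigraph g" "q' \<in> ereal_epigraph g"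
      using p q by (auto simp: Q_def)
    have "(1 - t) *\<^sub>R p' + t *\<^sub>R q' \<in> ereal_epigraph g"
      using g pq(3,4) t unfolding convex_fun_def convex_alt by blast
    moreover have "(1 - t) *\<^sub>R p + t *\<^sub>R q = A ((1 - t) *\<^sub>R p' + t *\<^sub>R q')"
      unfolding pq
      by (cases p'; cases q')
        (simp add: A_def linear_add[OF J] linear_scale[OF J] linear_diff[OF J] algebra_simps inner_add inner_diff)
    ultimately show "(1 - t) *\<^sub>R p + t *\<^sub>R q \<in> Q" unfolding Q_def by (metis imageI)
  qed
  moreover have "(0, h 0 + 1) \<in> P" by (simp add: P_def)
  then have "P \<noteq> {}" by blast
  moreover have "(x, \<gamma>) \<in> ereal_epigraph g" by (simp add: ereal_epigraph_def \<gamma>)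
  then have "Q \<noteq> {}" by (auto simp: Q_def)
  moreover have "Q \<inter> P = {}"
    using sub' by (force simp: Q_def P_def A_def ereal_epigraph_def)
  ultimately obtain z k where z: "z \<noteq> 0" "\<And>p. p \<in> Q \<Longrightarrow> z \<bullet> p \<le> k" "\<And>p. p \<in> P \<Longrightarrow> k \<le> z \<bullet> p"
    using separating_hyperplane_sets[of Q P] by metis
  obtain w \<tau> where w: "z = (w, \<tau>)" by (cases z)
  have above: "k \<le> w \<bullet> u + \<tau> * a" if "h u < a" for u a
    using z(3)[of "(u, a)"] that by (simp add: w P_def)
  have below: "w \<bullet> (b + J y) + \<tau> * (\<eta> + \<gamma> + v \<bullet> (y - x) - \<beta>) \<le> k" if "g y \<le> ereal \<beta>" for y \<beta>
  proof -
    have "A (y, \<beta>) \<in> Q" unfolding Q_def by (rule imageI) (use that in \<open>simp add: ereal_epigraph_def\<close>)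
    from z(2)[OF this] show ?thesis by (simp add: w A_def)
  qed
  have "0 \<le> \<tau>"
  proof (rule ccontr)
    assume "\<not> 0 \<le> \<tau>"
    then have neg: "\<tau> < 0" by simp
    define n where "n = (\<bar>k - w \<bullet> 0 - \<tau> * h 0\<bar> + 1) / - \<tau>"
    have "0 < n" using neg by (simp add: n_def divide_pos_neg)
    then have "k \<le> w \<bullet> 0 + \<tau> * (h 0 + n)" by (intro above) simp
    moreover have "\<tau> * n = - (\<bar>k - w \<bullet> 0 - \<tau> * h 0\<bar> + 1)" using neg by (simp add: n_def)
    ultimately show False by (simp add: algebra_simps)
  qed
  moreover have "\<tau> \<noteq> 0"
  proof
    assume \<tau>: "\<tau> = 0"
    then have w0: "w \<noteq> 0" using z(1) w by (simp add: zero_prod_def)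
    define u where "u = (- (\<bar>k\<bar> + 1) / (w \<bullet> w)) *\<^sub>R w"
    have "k \<le> w \<bullet> u + \<tau> * (h u + 1)" by (rule above) simp
    moreover have "w \<bullet> u = - (\<bar>k\<bar> + 1)" using w0 by (simp add: u_def)
    ultimately show False using \<tau> by simp
  qed
  ultimately have \<tau>: "0 < \<tau>" by simp
  have above': "k \<le> w \<bullet> u + \<tau> * h u" for u
  proof (rule field_le_epsilon)
    fix e :: real assume "0 < e"
    then have "k \<le> w \<bullet> u + \<tau> * (h u + e / \<tau>)" using \<tau> by (intro above) simp
    also have "\<dots> = w \<bullet> u + \<tau> * h u + e" using \<tau> by (simp add: field_simps)
    finally show "k \<le> w \<bullet> u + \<tau> * h u + e" .
  qed
  have k: "k = w \<bullet> (b + J x) + \<tau> * \<eta>"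
    using above'[of "b + J x"] below[of x \<gamma>] by (simp add: \<gamma> \<eta>_def)
  define w' where "w' = - (1 / \<tau>) *\<^sub>R w"
  have w': "w \<bullet> u = - \<tau> * (w' \<bullet> u)" for u using \<tau> by (simp add: w'_def)
  show thesis
  proof
    show "w' \<in> convex_subdifferential (\<lambda>u. ereal (h u)) (b + J x)"
      unfolding convex_subdifferential_real
    proof
      fix u
      have "\<tau> * (\<eta> + w' \<bullet> (u - (b + J x))) \<le> \<tau> * h u"
        using above'[of u] unfolding k w' by (simp add: algebra_simps inner_diff_right inner_add_right)
      then show "h (b + J x) + w' \<bullet> (u - (b + J x)) \<le> h u" using \<tau> by (simp add: \<eta>_def)
    qed
    have ineq: "\<gamma> + (v - adjoint J w') \<bullet> (y - x) \<le> \<beta>" if "g y \<le> ereal \<beta>" for y \<beta>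
    proof -
      have adj: "adjoint J w' \<bullet> (y - x) = w' \<bullet> J y - w' \<bullet> J x"
        by (simp add: adjoint_works[OF J] linear_diff[OF J] inner_diff_right inner_commute)
      have "\<tau> * (\<gamma> + v \<bullet> (y - x) - \<beta>) \<le> \<tau> * (w' \<bullet> J y - w' \<bullet> J x)"
        using below[OF that] unfolding k w' by (simp add: algebra_simps inner_add_right)
      then have "\<gamma> + v \<bullet> (y - x) - \<beta> \<le> w' \<bullet> J y - w' \<bullet> J x" using \<tau> by simp
      then show ?thesis by (simp add: inner_diff_left adj)
    qed
    have "g x + ereal ((v - adjoint J w') \<bullet> (y - x)) \<le> g y" for y
      by (rule ereal_le_real) (use ineq in \<open>auto simp: \<gamma>\<close>)
    with fin show "v - adjoint J w' \<in> convex_subdifferential g x"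
      by (simp add: convex_subdifferential_def)
  qed
qed

lemma inner_self_nonpos: "v \<bullet> v \<le> 0 \<Longrightarrow> v = 0"
  by (metis inner_eq_zero_iff inner_ge_zero order_antisym)

lemma adjoint_id: "adjoint (\<lambda>x. x) = (\<lambda>x::'a::real_inner. x)"
  by (rule adjoint_unique) simp

lemma convex_subdifferential_add:
  fixes g :: "'a::euclidean_space \<Rightarrow> ereal"
  assumes g: "convex_fun g" and f: "convex_on UNIV f"
  shows "convex_subdifferential (\<lambda>y. g y + ereal (f y)) x =
    convex_subdifferential g x + convex_subdifferential (\<lambda>y. ereal (f y)) x"
proof (intro equalityI subsetI)
  fix v assume "v \<in> convex_subdifferential (\<lambda>y. g y + ereal (f y)) x"
  then obtain w where w: "w \<in> convex_subdifferential (\<lambda>y. ereal (f y)) x" "v - w \<in> convex_subdifferential g x"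
    using convex_subgradient_split[OF g f linear_id, of v 0 x]
    by (auto simp: id_def adjoint_id)
  have "(v - w) + w \<in> convex_subdifferential g x + convex_subdifferential (\<lambda>y. ereal (f y)) x"
    by (intro set_plus_intro w)
  then show "v \<in> convex_subdifferential g x + convex_subdifferential (\<lambda>y. ereal (f y)) x" by simp
next
  fix v assume "v \<in> convex_subdifferential g x + convex_subdifferential (\<lambda>y. ereal (f y)) x"
  then obtain a w where v: "v = a + w" and a: "a \<in> convex_subdifferential g x"
    and w: "w \<in> convex_subdifferential (\<lambda>y. ereal (f y)) x" by (rule set_plus_elim)
  have fin: "\<bar>g x\<bar> \<noteq> \<infinity>" using a by (simp add: convex_subdifferential_def)
  have "g x + ereal (f x) + ereal (v \<bullet> (y - x)) \<le> g y + ereal (f y)" for y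
  proof -
    have "g x + ereal (f x) + ereal (v \<bullet> (y - x))
        = (g x + ereal (a \<bullet> (y - x))) + ereal (f x + w \<bullet> (y - x))"
      using fin by (cases "g x") (auto simp: v inner_add_left)
    also have "\<dots> \<le> g y + ereal (f y)"
      using a w by (intro add_mono) (auto simp: convex_subdifferential_def)
    finally show ?thesis .
  qed
  then show "v \<in> convex_subdifferential (\<lambda>y. g y + ereal (f y)) x"
    using fin by (cases "g x") (auto simp: convex_subdifferential_def)
qed

lemma convex_fun_add_real:
  assumes g: "convex_fun g" and f: "convex_on UNIV f"
  shows "convex_fun (\<lambda>y. g y + ereal (f y))"
  unfolding convex_fun_iff ereal_add_real_le_iff
proof (intro allI ballI impI)
  fix y z a b and t :: real
  assume t: "t \<in> {0..1}" and ab: "g y \<le> ereal (a - f y)" "g z \<le> ereal (b - f z)"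
  have "g ((1 - t) *\<^sub>R y + t *\<^sub>R z) \<le> ereal ((1 - t) * (a - f y) + t * (b - f z))"
    using g t ab unfolding convex_fun_iff by blast
  moreover have "f ((1 - t) *\<^sub>R y + t *\<^sub>R z) \<le> (1 - t) * f y + t * f z"
    using t by (intro convex_onD[OF f]) auto
  ultimately show "g ((1 - t) *\<^sub>R y + t *\<^sub>R z)
      \<le> ereal ((1 - t) * a + t * b - f ((1 - t) *\<^sub>R y + t *\<^sub>R z))"
    by (elim order_trans) (simp add: algebra_simps)
qed

lemma convex_subdifferential_add_real:
  fixes f f' :: "'a::euclidean_space \<Rightarrow> real"
  assumes "convex_on UNIV f" "convex_on UNIV f'"
  shows "convex_subdifferential (\<lambda>y. ereal (f y + f' y)) x =
    convex_subdifferential (\<lambda>y. ereal (f y)) x + convex_subdifferential (\<lambda>y. ereal (f' y)) x"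
  using convex_subdifferential_add[of "\<lambda>y. ereal (f y)" f' x] assms
  by (simp add: convex_fun_ereal_iff)

lemma convex_subdifferential_affine_compose:
  fixes h :: "'b::euclidean_space \<Rightarrow> real" and J :: "'a::euclidean_space \<Rightarrow> 'b"
  assumes h: "convex_on UNIV h" and J: "linear J"
  shows "convex_subdifferential (\<lambda>y. ereal (h (b + J y))) x =
    adjoint J ` convex_subdifferential (\<lambda>u. ereal (h u)) (b + J x)"
proof (intro equalityI subsetI)
  fix v assume "v \<in> convex_subdifferential (\<lambda>y. ereal (h (b + J y))) x"
  then have v: "v \<in> convex_subdifferential (\<lambda>y. 0 + ereal (h (b + J y))) x" by simp
  have zero: "convex_fun (\<lambda>_::'a. 0)" by (simp add: convex_fun_iff)
  obtain w where w: "w \<in> convex_subdifferential (\<lambda>u. ereal (h u)) (b + J x)"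
    and z: "v - adjoint J w \<in> convex_subdifferential (\<lambda>_. 0) x"
    using convex_subgradient_split[OF zero h J v] .
  have "0 + ereal ((v - adjoint J w) \<bullet> ((x + (v - adjoint J w)) - x)) \<le> 0"
    using z unfolding convex_subdifferential_def by blast
  then have "v - adjoint J w = 0" by (intro inner_self_nonpos) simp
  then have "v = adjoint J w" by simp
  with w show "v \<in> adjoint J ` convex_subdifferential (\<lambda>u. ereal (h u)) (b + J x)" by blast
next
  fix v assume "v \<in> adjoint J ` convex_subdifferential (\<lambda>u. ereal (h u)) (b + J x)"
  then obtain w where v: "v = adjoint J w"
    and w: "\<And>u. h (b + J x) + w \<bullet> (u - (b + J x)) \<le> h u"
    by (auto simp: convex_subdifferential_real)
  have "v \<bullet> (y - x) = w \<bullet> ((b + J y) - (b + J x))" for y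
    by (simp add: v adjoint_works[OF J] linear_diff[OF J] inner_commute)
  then show "v \<in> convex_subdifferential (\<lambda>y. ereal (h (b + J y))) x"
    unfolding convex_subdifferential_real using w by presburger
qed

lemma convex_subdifferential_nonempty:
  fixes f :: "'a::euclidean_space \<Rightarrow> real"
  assumes f: "convex_on UNIV f"
  shows "convex_subdifferential (\<lambda>y. ereal (f y)) x \<noteq> {}"
proof -
  \<comment> \<open>Adding the indicator of \<open>{x}\<close> makes \<open>0\<close> a subgradient, which then splits.\<close>
  define g where "g = (\<lambda>y. if y = x then 0 else \<infinity> :: ereal)"
  have g: "convex_fun g"
    unfolding convex_fun_iff g_def by (auto simp: algebra_simps simp flip: scaleR_add_left; smt (verit) mult_left_le mult_nonneg_nonneg)
  have "0 \<in> convex_subdifferential (\<lambda>y. g y + ereal (f y)) x"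
    by (auto simp: convex_subdifferential_def g_def)
  then show ?thesis
    unfolding convex_subdifferential_add[OF g f] by (auto elim: set_plus_elim)
qed

lemma convex_subdifferential_scale:
  fixes f :: "'a::euclidean_space \<Rightarrow> real"
  assumes f: "convex_on UNIV f" and c: "0 \<le> c"
  shows "convex_subdifferential (\<lambda>y. ereal (c * f y)) x =
    (\<lambda>v. c *\<^sub>R v) ` convex_subdifferential (\<lambda>y. ereal (f y)) x"
proof (cases "c = 0")
  case True
  have "convex_subdifferential (\<lambda>_. ereal 0) x = {0}"
  proof (intro equalityI subsetI)
    fix v assume "v \<in> convex_subdifferential (\<lambda>_. ereal 0) x"
    then have "0 + v \<bullet> (x + v - x) \<le> 0" unfolding convex_subdifferential_real by blast
    then show "v \<in> {0}" by (simp add: inner_self_nonpos)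
  qed (simp add: convex_subdifferential_real)
  \<comment> \<open>For \<open>c = 0\<close> the right-hand side is \<open>{0}\<close> only because a finite convex function has subgradients.\<close>
  then show ?thesis using convex_subdifferential_nonempty[OF f, of x] True by auto
next
  case False
  then have c: "0 < c" using c by simp
  show ?thesis
  proof (intro equalityI subsetI)
    fix v assume v: "v \<in> convex_subdifferential (\<lambda>y. ereal (c * f y)) x"
    have "(1 / c) *\<^sub>R v \<in> convex_subdifferential (\<lambda>y. ereal (f y)) x"
      unfolding convex_subdifferential_real
    proof
      fix y
      have "c * f x + v \<bullet> (y - x) \<le> c * f y" using v unfolding convex_subdifferential_real by blast
      then show "f x + ((1 / c) *\<^sub>R v) \<bullet> (y - x) \<le> f y" using c by (simp add: field_simps)
    qed
    then have "c *\<^sub>R ((1 / c) *\<^sub>R v) \<in> (\<lambda>v. c *\<^sub>R v) ` convex_subdifferential (\<lambda>y. ereal (f y)) x"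
      by (rule imageI)
    then show "v \<in> (\<lambda>v. c *\<^sub>R v) ` convex_subdifferential (\<lambda>y. ereal (f y)) x" using c by simp
  next
    fix v assume "v \<in> (\<lambda>v. c *\<^sub>R v) ` convex_subdifferential (\<lambda>y. ereal (f y)) x"
    then obtain w where v: "v = c *\<^sub>R w" and w: "\<And>y. f x + w \<bullet> (y - x) \<le> f y"
      using convex_subdifferential_real by blast
    have "c * f x + v \<bullet> (y - x) \<le> c * f y" for y
      using mult_left_mono[OF w[of y], of c] c by (simp add: v algebra_simps)
    then show "v \<in> convex_subdifferential (\<lambda>y. ereal (c * f y)) x"
      by (simp add: convex_subdifferential_real)
  qed
qed

lemma convex_subdifferential_linear:
  "convex_subdifferential (\<lambda>y. ereal (w \<bullet> y)) x = {w}"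
proof (intro equalityI subsetI)
  fix v assume "v \<in> convex_subdifferential (\<lambda>y. ereal (w \<bullet> y)) x"
  then have "w \<bullet> x + v \<bullet> ((x + (v - w)) - x) \<le> w \<bullet> (x + (v - w))"
    unfolding convex_subdifferential_real by blast
  then have "(v - w) \<bullet> (v - w) \<le> 0" by (simp add: inner_diff inner_add)
  then have "v - w = 0" by (rule inner_self_nonpos)
  then show "v \<in> {w}" by simp
qed (auto simp: convex_subdifferential_real inner_diff_right)

lemma convex_on_sum_UNIV:
  assumes "finite S" "\<And>i. i \<in> S \<Longrightarrow> convex_on UNIV (f i)"
  shows "convex_on UNIV (\<lambda>y. \<Sum>i\<in>S. f i y)"
  using assms by (induction S rule: finite_induct) (auto intro: convex_on_add convex_onI)

lemma convex_subdifferential_sum: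
  fixes f :: "'i \<Rightarrow> 'a::euclidean_space \<Rightarrow> real"
  assumes "finite S" "\<And>i. i \<in> S \<Longrightarrow> convex_on UNIV (f i)"
  shows "convex_subdifferential (\<lambda>y. ereal (\<Sum>i\<in>S. f i y)) x =
    (\<Sum>i\<in>S. convex_subdifferential (\<lambda>y. ereal (f i y)) x)"
  using assms
proof (induction S rule: finite_induct)
  case empty
  have "convex_subdifferential (\<lambda>y. ereal (0 \<bullet> y)) x = {0}" by (rule convex_subdifferential_linear)
  then show ?case by (simp add: set_zero)
next
  case (insert i S)
  have "convex_subdifferential (\<lambda>y. ereal (f i y + (\<Sum>j\<in>S. f j y))) x =
      convex_subdifferential (\<lambda>y. ereal (f i y)) x +
      convex_subdifferential (\<lambda>y. ereal (\<Sum>j\<in>S. f j y)) x"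
    using insert by (intro convex_subdifferential_add_real convex_on_sum_UNIV) auto
  then show ?case using insert by simp
qed

section \<open>The subdifferential of the composite function\<close>

text \<open>Frechet subgradients see only first-order behaviour. This replaces a nonconvex function by a convex
  model with the same first-order behaviour at the point.\<close>

lemma frechet_subdifferential_add_cong:
  fixes \<phi> \<gamma> :: "'a::real_inner \<Rightarrow> real"
  assumes d: "((\<lambda>y. \<phi> y - \<gamma> y) has_derivative (\<lambda>_. 0)) (at x)"
  shows "frechet_subdifferential (\<lambda>y. g y + ereal (\<phi> y)) x =
    frechet_subdifferential (\<lambda>y. g y + ereal (\<gamma> y)) x"
proof -
  have sub: "frechet_subdifferential (\<lambda>y. g y + ereal (\<phi> y)) x
      \<subseteq> frechet_subdifferential (\<lambda>y. g y + ereal (\<gamma> y)) x"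
    if d: "((\<lambda>y. \<phi> y - \<gamma> y) has_derivative (\<lambda>_. 0)) (at x)" for \<phi> \<gamma> :: "'a \<Rightarrow> real"
  proof
    fix v assume v: "v \<in> frechet_subdifferential (\<lambda>y. g y + ereal (\<phi> y)) x"
    then have fin: "\<bar>g x\<bar> \<noteq> \<infinity>" by (cases "g x") (auto simp: frechet_subdifferential_def)
    then obtain a where a: "g x = ereal a" by (cases "g x") auto
    show "v \<in> frechet_subdifferential (\<lambda>y. g y + ereal (\<gamma> y)) x"
      unfolding frechet_subdifferential_iff
    proof (intro conjI allI impI)
      fix \<epsilon> :: real assume "0 < \<epsilon>"
      then have e: "0 < \<epsilon> / 2" by simp
      obtain d1 where d1: "0 < d1" "\<And>y. y \<in> ball x d1 \<Longrightarrow>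
          g x + ereal (\<phi> x) + ereal (v \<bullet> (y - x) - \<epsilon> / 2 * norm (y - x)) \<le> g y + ereal (\<phi> y)"
        using v e unfolding frechet_subdifferential_iff by blast
      obtain d2 where d2: "0 < d2" "\<And>y. norm (y - x) < d2 \<Longrightarrow>
          \<bar>\<phi> y - \<gamma> y - (\<phi> x - \<gamma> x)\<bar> \<le> \<epsilon> / 2 * norm (y - x)"
        using d[unfolded has_derivative_at_alt, THEN conjunct2, rule_format, OF e]
        unfolding diff_zero real_norm_def by blast
      have "g x + ereal (\<gamma> x) + ereal (v \<bullet> (y - x) - \<epsilon> * norm (y - x)) \<le> g y + ereal (\<gamma> y)"
        if y: "y \<in> ball x (min d1 d2)" for y
      proof -
        define N where "N = \<epsilon> / 2 * norm (y - x)"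
        have N: "\<epsilon> * norm (y - x) = 2 * N" by (simp add: N_def)
        have near: "\<bar>\<phi> y - \<gamma> y - (\<phi> x - \<gamma> x)\<bar> \<le> N"
          unfolding N_def using y by (intro d2(2)) (simp add: dist_norm norm_minus_commute)
        have le: "g x + ereal (\<phi> x) + ereal (v \<bullet> (y - x) - N) \<le> g y + ereal (\<phi> y)"
          unfolding N_def using y by (intro d1(2)) simp
        show ?thesis
          unfolding N using le near by (cases "g y") (simp_all add: a)
      qed
      then show "\<exists>\<delta>>0. \<forall>y\<in>ball x \<delta>.
          g x + ereal (\<gamma> x) + ereal (v \<bullet> (y - x) - \<epsilon> * norm (y - x)) \<le> g y + ereal (\<gamma> y)"
        using d1(1) d2(1) by (intro exI[of _ "min d1 d2"]) auto
    qed (simp add: a)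
  qed
  have "((\<lambda>y. \<gamma> y - \<phi> y) has_derivative (\<lambda>_. 0)) (at x)"
    using has_derivative_minus[OF d] by simp
  from sub[OF d] sub[OF this] show ?thesis by (rule equalityI)
qed

text \<open>The Lipschitz function \<open>h\<close> keeps the linearization error of \<open>C\<close> of order \<open>o(norm (y - x))\<close>.\<close>

lemma has_derivative_linearized_inner:
  fixes h :: "'b::real_normed_vector \<Rightarrow> real"
  assumes h: "L-lipschitz_on (ball (C x) \<rho>) h" "0 < \<rho>" and C: "(C has_derivative J) (at x)"
  shows "((\<lambda>y. h (C y) - h (C x - J x + J y)) has_derivative (\<lambda>_. 0)) (at x)"
  unfolding has_derivative_at_alt
proof (intro conjI allI impI)
  fix \<epsilon> :: real assume e: "0 < \<epsilon>"
  interpret J: bounded_linear J using C by (rule has_derivative_bounded_linear)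
  have L0: "0 \<le> L" using h(1) by (rule lipschitz_on_nonneg)
  define \<eta> where "\<eta> = \<epsilon> / (1 + L)"
  have eta: "0 < \<eta>" "L * \<eta> \<le> \<epsilon>" using e L0 by (auto simp: \<eta>_def field_simps)
  obtain d1 where d1: "0 < d1"
    "\<And>y. norm (y - x) < d1 \<Longrightarrow> norm (C y - C x - J (y - x)) \<le> \<eta> * norm (y - x)"
    using C eta unfolding has_derivative_at_alt by blast
  have "isCont C x" using C by (rule has_derivative_continuous)
  then obtain d2 where d2: "0 < d2" "\<And>y. norm (y - x) < d2 \<Longrightarrow> C y \<in> ball (C x) \<rho>"
    using h(2) unfolding continuous_at_eps_delta by (metis dist_commute dist_norm mem_ball)
  have "\<forall>\<^sub>F y in nhds x. C x - J x + J y \<in> ball (C x) \<rho>"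
  proof (rule topological_tendstoD)
    show "((\<lambda>y. C x - J x + J y) \<longlongrightarrow> C x - J x + J x) (nhds x)"
      by (intro tendsto_add tendsto_const J.tendsto) (rule filterlim_ident)
  qed (use h(2) in simp_all)
  then obtain d3 where d3: "0 < d3" "\<And>y. dist y x < d3 \<Longrightarrow> C x - J x + J y \<in> ball (C x) \<rho>"
    unfolding eventually_nhds_metric by metis
  have "norm (h (C y) - h (C x - J x + J y) - (h (C x) - h (C x - J x + J x)) - 0) \<le> \<epsilon> * norm (y - x)"
    if y: "norm (y - x) < Min {d1, d2, d3}" for y
  proof -
    have "norm (h (C y) - h (C x - J x + J y)) \<le> L * norm (C y - (C x - J x + J y))"
      using lipschitz_onD[OF h(1) d2(2) d3(2)] y by (simp add: dist_norm)
    also have "C y - (C x - J x + J y) = C y - C x - J (y - x)" by (simp add: J.diff)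
    also have "L * norm \<dots> \<le> L * (\<eta> * norm (y - x))"
      using y L0 by (intro mult_left_mono d1(2)) auto
    also have "\<dots> = L * \<eta> * norm (y - x)" by simp
    also have "\<dots> \<le> \<epsilon> * norm (y - x)" using eta by (intro mult_right_mono) auto
    finally show ?thesis by simp
  qed
  then show "\<exists>d>0. \<forall>y. norm (y - x) < d \<longrightarrow>
      norm (h (C y) - h (C x - J x + J y) - (h (C x) - h (C x - J x + J x)) - 0) \<le> \<epsilon> * norm (y - x)"
    using d1(1) d2(1) d3(1) by (intro exI[of _ "Min {d1, d2, d3}"]) auto
qed simp

lemma partial_deriv_eq:
  assumes "(f has_derivative A) (at x)"
  shows "partial_deriv i f x = A (axis i 1)"
proof -
  interpret A: bounded_linear A using assms by (rule has_derivative_bounded_linear)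
  have "((\<lambda>t. f (x + t *\<^sub>R axis i 1)) has_derivative (\<lambda>t. A (t *\<^sub>R axis i 1))) (at 0)"
    by (rule has_derivative_compose[of "\<lambda>t. x + t *\<^sub>R axis i 1", where g = f and g' = A])
      (auto intro!: derivative_eq_intros simp: assms)
  moreover have "(\<lambda>t. A (t *\<^sub>R axis i 1)) = (*) (A (axis i 1))"
    by (auto simp: A.scaleR)
  ultimately have "((\<lambda>t. f (x + t *\<^sub>R axis i 1)) has_field_derivative A (axis i 1)) (at 0)"
    by (simp add: has_field_derivative_def)
  then show ?thesis unfolding partial_deriv_def by (rule DERIV_imp_deriv)
qed

lemma has_derivative_eq_inner_gradient:
  assumes "(f has_derivative A) (at x)"
  shows "A u = gradient f x \<bullet> u"
proof -
  interpret A: bounded_linear A using assms by (rule has_derivative_bounded_linear)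
  have "A u = A (\<Sum>i\<in>UNIV. u $ i *\<^sub>R axis i 1)"
    by (simp add: basis_expansion flip: scalar_mult_eq_scaleR)
  also have "\<dots> = (\<Sum>i\<in>UNIV. u $ i * A (axis i 1))" by (simp add: A.sum A.scaleR)
  also have "\<dots> = gradient f x \<bullet> u"
    by (simp add: inner_vec_def gradient_def partial_deriv_eq[OF assms] mult.commute)
  finally show ?thesis .
qed

lemma closed_fun_add_continuous:
  assumes g: "closed_fun g" and \<phi>: "continuous_on UNIV \<phi>"
  shows "closed_fun (\<lambda>y. g y + ereal (\<phi> y))"
proof -
  have "ereal_epigraph (\<lambda>y. g y + ereal (\<phi> y)) =
      (\<lambda>p. (fst p, snd p - \<phi> (fst p))) -` ereal_epigraph g"
    by (auto simp: ereal_epigraph_def ereal_add_real_le_iff)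
  moreover have "continuous_on UNIV (\<lambda>p. (fst p, snd p - \<phi> (fst p)))"
    by (intro continuous_intros continuous_on_compose2[OF \<phi>]) auto
  ultimately show ?thesis using g unfolding closed_fun_def by (simp add: closed_vimage)
qed

theorem theorem3p1:
  fixes g :: "real ^ 'm::finite \<Rightarrow> ereal"
    and h :: "real ^ 'd::finite \<Rightarrow> real"
    and C :: "real ^ 'm \<Rightarrow> real ^ 'd"
    and s :: "real ^ 'n::finite \<Rightarrow> real"
    and r :: "'n \<Rightarrow> real ^ 'm \<Rightarrow> real"
    and R :: "real ^ 'm \<Rightarrow> real ^ 'n"
    and F :: "real ^ 'm \<Rightarrow> ereal"
    and xbar :: "real ^ 'm"
    and W :: "(real ^ 'n) set"
    and I :: "'n set"
  defines "R \<equiv> \<lambda>x. \<chi> i. r i x"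
    and "F \<equiv> \<lambda>x. g x + ereal (h (C x)) + ereal (s (R x))"
    and "I \<equiv> {i. \<forall>z\<in>W. 0 \<le> partial_deriv i s z}"
  assumes g: "proper_fun g" "closed_fun g" "convex_fun g"
    and h: "closed_fun (\<lambda>y. ereal (h y))" "convex_fun (\<lambda>y. ereal (h y))"
    and C: "continuously_differentiable_on C UNIV"
    and s: "continuously_differentiable_on s UNIV"
    and r: "\<And>i. closed_fun (\<lambda>x. ereal (r i x))" "\<And>i. convex_fun (\<lambda>x. ereal (r i x))"
    and xbar: "xbar \<in> effective_domain F"
    and W: "R xbar \<in> interior W"
    and sign: "\<And>i. \<not> continuously_differentiable_near (r i) xbar \<Longrightarrow>
                 \<forall>z\<in>W. 0 \<le> partial_deriv i s z"
  shows "(\<forall>i. i \<notin> I \<longrightarrow> continuously_differentiable_near (r i) xbar) \<and>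
    subdifferentially_regular_at F xbar \<and>
    frechet_subdifferential F xbar = limiting_subdifferential F xbar \<and>
    limiting_subdifferential F xbar =
      convex_subdifferential g xbar
      + (\<lambda>w. transpose (jacobian C (at xbar)) *v w) `
          convex_subdifferential (\<lambda>y. ereal (h y)) (C xbar)
      + (\<Sum>i\<in>I. (\<lambda>v. partial_deriv i s (R xbar) *\<^sub>R v) `
          convex_subdifferential (\<lambda>x. ereal (r i x)) xbar)
      + (\<Sum>i\<in>- I. {partial_deriv i s (R xbar) *\<^sub>R gradient (r i) xbar})"
proof -
  define c where "c = (\<lambda>i. partial_deriv i s (R xbar))"
  define J where "J = (\<lambda>v. jacobian C (at xbar) *v v)"
  have smooth: "\<forall>i. i \<notin> I \<longrightarrow> continuously_differentiable_near (r i) xbar"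
    using sign unfolding I_def by blast
  have c_nonneg: "0 \<le> c i" if "i \<in> I" for i
    using that W interior_subset[of W] by (auto simp: I_def c_def)
  have h_convex: "convex_on UNIV h" and r_convex: "\<And>i. convex_on UNIV (r i)"
    using h r by (simp_all add: convex_fun_ereal_iff)
  have near_C: "continuously_differentiable_near C x" for x
    using C unfolding continuously_differentiable_near_def by blast
  have near_s: "continuously_differentiable_near s x" for x
    using s unfolding continuously_differentiable_near_def by blast
  obtain A\<^sub>C where A\<^sub>C: "has_strict_derivative C A\<^sub>C xbar"
    using continuously_differentiable_near_imp_has_strict_derivative[OF near_C] by blast
  have C_deriv: "(C has_derivative J) (at xbar)"
    unfolding J_def jacobian_works[symmetric]
    using has_strict_derivative_imp_has_derivative[OF A\<^sub>C] by (rule differentiableI)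
  obtain A where A: "has_strict_derivative s A (R xbar)"
    using continuously_differentiable_near_imp_has_strict_derivative[OF near_s] by blast
  have A_eq: "A (R y) = (\<Sum>i\<in>I. c i * r i y) + (\<Sum>i\<in>-I. c i * r i y)" for y
  proof -
    have "A (R y) = (\<Sum>i\<in>UNIV. c i * r i y)"
      unfolding has_derivative_eq_inner_gradient[OF has_strict_derivative_imp_has_derivative[OF A]]
      by (simp add: inner_vec_def gradient_def c_def R_def)
    then show ?thesis
      using sum.Int_Diff[of UNIV "\<lambda>i. c i * r i y" I] by (simp add: Compl_eq_Diff_UNIV)
  qed
  have "\<exists>\<delta>>0. \<exists>L. L-lipschitz_on (ball xbar \<delta>) (r i)" for i
    using convex_on_UNIV_locally_lipschitz[OF r_convex] by metis
  then obtain \<rho> L where R_lip: "0 < \<rho>" "L-lipschitz_on (ball xbar \<rho>) R"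
    unfolding R_def by (rule locally_lipschitz_vec_lambda)
  have remainder: "has_strict_derivative (\<lambda>y. s (R y) - A (R y)) (\<lambda>_. 0) xbar"
    by (rule has_strict_derivative_compose_minus_linear[OF A R_lip(2,1)])
  have r_deriv: "(r i has_derivative (\<lambda>u. gradient (r i) xbar \<bullet> u)) (at xbar)" if i: "i \<notin> I" for i
  proof -
    obtain B where "has_strict_derivative (r i) B xbar"
      using smooth i continuously_differentiable_near_imp_has_strict_derivative by blast
    then have B: "(r i has_derivative B) (at xbar)" by (rule has_strict_derivative_imp_has_derivative)
    moreover have "B = (\<lambda>u. gradient (r i) xbar \<bullet> u)"
      using has_derivative_eq_inner_gradient[OF B] by blast
    ultimately show ?thesis by simp
  qed

  have F_split: "F = (\<lambda>y. g y + ereal (h (C y)) + ereal (s (R y) - A (R y))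
      + ereal (\<Sum>i\<in>I. c i * r i y) + ereal (\<Sum>i\<in>-I. c i * r i y))"
    by (simp add: F_def A_eq add.assoc)
  have F_convex: "approximately_convex_at F xbar"
    unfolding F_split
  proof (intro approximately_convex_at_add)
    show "approximately_convex_at g xbar"
      by (rule convex_fun_imp_approximately_convex_at[OF g(3)])
    show "approximately_convex_at (\<lambda>y. ereal (h (C y))) xbar"
      by (rule approximately_convex_at_convex_compose[OF h_convex A\<^sub>C])
    show "approximately_convex_at (\<lambda>y. ereal (s (R y) - A (R y))) xbar"
      by (rule has_strict_derivative_imp_approximately_convex_at[OF remainder])
    show "approximately_convex_at (\<lambda>y. ereal (\<Sum>i\<in>I. c i * r i y)) xbar"
      by (intro convex_fun_imp_approximately_convex_at)
        (auto simp: convex_fun_ereal_iff intro!: convex_on_sum_UNIV convex_on_cmul c_nonneg r_convex)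
    show "approximately_convex_at (\<lambda>y. ereal (\<Sum>i\<in>-I. c i * r i y)) xbar"
    proof (rule approximately_convex_at_sum)
      fix i assume "i \<in> - I"
      then obtain B where "has_strict_derivative (r i) B xbar"
        using smooth continuously_differentiable_near_imp_has_strict_derivative by blast
      from has_strict_derivative_scaleR[OF this, of "c i"]
      show "approximately_convex_at (\<lambda>y. ereal (c i * r i y)) xbar"
        by (intro has_strict_derivative_imp_approximately_convex_at) auto
    qed simp
  qed

  define \<phi> where "\<phi> = (\<lambda>y. h (C y) + s (R y))"
  have F_\<phi>: "F = (\<lambda>y. g y + ereal (\<phi> y))"
    by (simp add: F_def \<phi>_def add.assoc)
  have "\<bar>g xbar\<bar> \<noteq> \<infinity>"
    using xbar g(1) by (cases "g xbar") (auto simp: F_\<phi> effective_domain_def proper_fun_def)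
  then have F_fin: "\<bar>F xbar\<bar> \<noteq> \<infinity>" by (auto simp: F_\<phi>)
  have cont_C: "continuous_on UNIV C" and cont_s: "continuous_on UNIV s"
    using continuously_differentiable_near_imp_has_strict_derivative[OF near_C]
      continuously_differentiable_near_imp_has_strict_derivative[OF near_s]
      has_strict_derivative_imp_has_derivative has_derivative_continuous
    by (metis continuous_at_imp_continuous_on)+
  have "continuous_on UNIV \<phi>"
    unfolding \<phi>_def R_def
    by (intro continuous_intros continuous_on_compose2[OF convex_on_continuous[OF open_UNIV h_convex] cont_C]
        continuous_on_compose2[OF cont_s] convex_on_continuous r_convex) auto
  then have "closed (ereal_epigraph F)"
    using closed_fun_add_continuous[OF g(2)] by (simp add: F_\<phi> closed_fun_def)
  then have regular: "subdifferentially_regular_at F xbar"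
    unfolding subdifferentially_regular_at_def
    using F_fin by (intro conjI clarke_regular_at_epigraph[OF F_convex]) (auto simp: ereal_real)

  \<comment> \<open>A convex model that agrees with \<open>\<phi>\<close> to first order at \<open>xbar\<close>.\<close>
  define \<gamma> where "\<gamma> = (\<lambda>y. h (C xbar - J xbar + J y) + ((\<Sum>i\<in>I. c i * r i y)
      + (\<Sum>i\<in>-I. (c i *\<^sub>R gradient (r i) xbar) \<bullet> y)))"
  have J: "linear J" unfolding J_def by (rule matrix_vector_mul_linear)
  have h_model: "convex_on UNIV (\<lambda>y. h (C xbar - J xbar + J y))"
  proof (rule convex_onI)
    fix t :: real and y z assume t: "0 < t" "t < 1"
    have "C xbar - J xbar + J ((1 - t) *\<^sub>R y + t *\<^sub>R z)
        = (1 - t) *\<^sub>R (C xbar - J xbar + J y) + t *\<^sub>R (C xbar - J xbar + J z)"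
      by (simp add: linear_add[OF J] linear_scale[OF J] linear_diff[OF J] algebra_simps)
    then show "h (C xbar - J xbar + J ((1 - t) *\<^sub>R y + t *\<^sub>R z))
        \<le> (1 - t) * h (C xbar - J xbar + J y) + t * h (C xbar - J xbar + J z)"
      using convex_onD[OF h_convex, of t] t by auto
  qed simp
  have I_model: "convex_on UNIV (\<lambda>y. c i * r i y)" if "i \<in> I" for i
    by (intro convex_on_cmul c_nonneg r_convex that)
  have lin_model: "convex_on UNIV (\<lambda>y. w \<bullet> y)" for w :: "real ^ 'm"
    by (rule convex_onI) (auto simp: inner_add_right)
  have sums_model: "convex_on UNIV (\<lambda>y. \<Sum>i\<in>I. c i * r i y)"
    "convex_on UNIV (\<lambda>y. \<Sum>i\<in>-I. (c i *\<^sub>R gradient (r i) xbar) \<bullet> y)"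
    by (intro convex_on_sum_UNIV I_model lin_model; simp)+
  have \<gamma>_convex: "convex_on UNIV \<gamma>"
    unfolding \<gamma>_def by (intro convex_on_add h_model sums_model)
  have \<phi>\<gamma>: "\<phi> y - \<gamma> y = (h (C y) - h (C xbar - J xbar + J y)) + (s (R y) - A (R y))
      + (\<Sum>i\<in>-I. c i * r i y - (c i *\<^sub>R gradient (r i) xbar) \<bullet> y)" for y
    by (simp add: \<phi>_def \<gamma>_def A_eq sum_subtractf)
  obtain \<rho>' L' where h_lip: "0 < \<rho>'" "L'-lipschitz_on (ball (C xbar) \<rho>') h"
    using convex_on_UNIV_locally_lipschitz[OF h_convex] .
  have summand: "((\<lambda>y. c i * r i y - (c i *\<^sub>R gradient (r i) xbar) \<bullet> y) has_derivative (\<lambda>_. 0)) (at xbar)"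
    if "i \<in> - I" for i
    by (rule derivative_eq_intros r_deriv refl | use that in simp)+
  have "((\<lambda>y. \<phi> y - \<gamma> y) has_derivative (\<lambda>_. 0 + 0 + (\<Sum>i\<in>-I. 0))) (at xbar)"
    unfolding \<phi>\<gamma>
    by (intro has_derivative_add has_derivative_sum summand
        has_derivative_linearized_inner[OF h_lip(2,1) C_deriv]
        has_strict_derivative_imp_has_derivative[OF remainder])
  then have "frechet_subdifferential F xbar = frechet_subdifferential (\<lambda>y. g y + ereal (\<gamma> y)) xbar"
    unfolding F_\<phi> by (intro frechet_subdifferential_add_cong) simp
  also have "\<dots> = convex_subdifferential (\<lambda>y. g y + ereal (\<gamma> y)) xbar"
    by (intro frechet_subdifferential_convex convex_fun_add_real g(3) \<gamma>_convex)
  also have "\<dots> = convex_subdifferential g xbar + convex_subdifferential (\<lambda>y. ereal (\<gamma> y)) xbar"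
    by (rule convex_subdifferential_add[OF g(3) \<gamma>_convex])
  also have "convex_subdifferential (\<lambda>y. ereal (\<gamma> y)) xbar =
      convex_subdifferential (\<lambda>y. ereal (h (C xbar - J xbar + J y))) xbar
      + (convex_subdifferential (\<lambda>y. ereal (\<Sum>i\<in>I. c i * r i y)) xbar
      + convex_subdifferential (\<lambda>y. ereal (\<Sum>i\<in>-I. (c i *\<^sub>R gradient (r i) xbar) \<bullet> y)) xbar)"
    unfolding \<gamma>_def
    by (simp only: convex_subdifferential_add_real convex_on_add h_model sums_model)
  also have "convex_subdifferential (\<lambda>y. ereal (h (C xbar - J xbar + J y))) xbar =
      (\<lambda>w. transpose (jacobian C (at xbar)) *v w) ` convex_subdifferential (\<lambda>y. ereal (h y)) (C xbar)"
    unfolding convex_subdifferential_affine_compose[OF h_convex J]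
    by (simp add: J_def adjoint_matrix)
  also have "convex_subdifferential (\<lambda>y. ereal (\<Sum>i\<in>I. c i * r i y)) xbar =
      (\<Sum>i\<in>I. (\<lambda>v. c i *\<^sub>R v) ` convex_subdifferential (\<lambda>x. ereal (r i x)) xbar)"
    using convex_subdifferential_sum[of I "\<lambda>i y. c i * r i y" xbar] I_model
    by (simp add: convex_subdifferential_scale[OF r_convex c_nonneg])
  also have "convex_subdifferential (\<lambda>y. ereal (\<Sum>i\<in>-I. (c i *\<^sub>R gradient (r i) xbar) \<bullet> y)) xbar =
      (\<Sum>i\<in>-I. {c i *\<^sub>R gradient (r i) xbar})"
    using convex_subdifferential_sum[of "-I" "\<lambda>i y. (c i *\<^sub>R gradient (r i) xbar) \<bullet> y" xbar]
    by (simp only: lin_model convex_subdifferential_linear finite)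
  finally have formula: "frechet_subdifferential F xbar = convex_subdifferential g xbar
      + (\<lambda>w. transpose (jacobian C (at xbar)) *v w) ` convex_subdifferential (\<lambda>y. ereal (h y)) (C xbar)
      + (\<Sum>i\<in>I. (\<lambda>v. c i *\<^sub>R v) ` convex_subdifferential (\<lambda>x. ereal (r i x)) xbar)
      + (\<Sum>i\<in>-I. {c i *\<^sub>R gradient (r i) xbar})"
    by (simp add: add.assoc)
  have limiting: "limiting_subdifferential F xbar = frechet_subdifferential F xbar"
    by (rule limiting_subdifferential_approximately_convex[OF F_convex])
  show ?thesis
    using smooth regular limiting formula unfolding c_def by simp
qed

end
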